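(* Suppose Assumptions (A) and (B) (stated in the context) hold, and let $\alpha^*\in(0,1)$ be defined as the unique solution of $$\frac{1}{\alpha^*}=\sum_{r\ge 2}p_r\sum_{i=1}^{r-1}\frac{1}{i-\alpha^*}.$$ If $(\hat\alpha_n,\hat\theta_n)$ maximizes the Ewens--Pitman likelihood $p_{\alpha,\theta}(N_{1,n},\dots,N_{K_n,n})$ as a function of $(\alpha,\theta)$, then $\hat\alpha_n\to\alpha^*$ in probability as $n\to\infty$. Moreover, writing $\beta=(\gamma-\alpha^* )/(1-\alpha^* )$, the following alternative regimes hold: 1. if $\alpha^*<\gamma$, then $\hat\theta_n=n^{\beta}\{\alpha^* C\,\ell(n)\}^{\frac{1}{1-\alpha^*}}(1+o_p(1))$; 2. if $\alpha^*=\gamma$ and $\ell(n)\to\infty$, then $\hat\theta_n=\{\gamma C\,\ell(n)\}^{\frac{1}{1-\gamma}}(1+o_p(1))$; 3. if $\alpha^*=\gamma$ and $\ell(n)=O(1)$, then $\hat\theta_n=O_p(1)$; 4. if $\alpha^*>\gamma$, then $\hat\theta_n=-\alpha^*+o_p(1)$.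
   Context: For each $n\ge1$ let $X_{1:n}=(X_1,\dots,X_n)$ be a random sample with $K_n$ distinct values, whose multiplicities (block sizes) are $(N_{1,n},\dots,N_{K_n,n})$, so $N_{j,n}\ge1$ and $\sum_{j=1}^{K_n}N_{j,n}=n$. For $r\ge1$ let $M_{r,n}=\sum_{j=1}^{K_n}\mathbf 1\{N_{j,n}=r\}$ be the number of blocks of size $r$. The data-generating mechanism of $X_{1:n}$ is only required to satisfy the assumptions below. The Ewens--Pitman likelihood is, for positive integers $n_1,\dots,n_k$ with $\sum_{i=1}^k n_i=n$, $$p_{\alpha,\theta}(n_1,\dots,n_k)=\frac{\prod_{i=1}^{k-1}(\theta+i\alpha)}{(\theta+1)_{n-1}}\prod_{j=1}^k(1-\alpha)_{n_j-1},\qquad \alpha\in(0,1),\ \theta>-\alpha,$$ where $(x)_m=\prod_{i=0}^{m-1}(x+i)$ is the rising factorial. A function $\ell:\mathbb R_+\to\mathbb R_+$ is slowly varying if $\ell(ax)/\ell(x)\to1$ as $x\to\infty$ for every $a>0$. Assumption (A): there exist a random variable $C$ with $0<C<\infty$ almost surely, a constant $\gamma\in(0,1)$ and a slowly varying function $\ell$ such that $K_n/(n^\gamma\ell(n))\to C$ in probability as $n\to\infty$. Assumption (B): there exists a probability mass function $(p_r)_{r\ge1}$ such that $\sum_{r\ge2}p_r\log r<\infty$, $M_{r,n}/K_n\to p_r$ in probability, and $\log n\sum_{r\ge2}\left|\frac{M_{r,n}}{K_n}-p_r\right|\log r\to0$ in probability, as $n\to\infty$. $c_n=o_p(1)$ means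 $c_n\to0$ in probability; $c_n=O_p(1)$ means $(c_n)_n$ is bounded in probability. *)

theory Defs
  imports "HOL-Probability.Probability"
begin

text \<open>
  Convergence and boundedness in probability include measurability: \<^const>\<open>measure\<close> is 0
  on non-measurable sets, so without it
  the limits below could hold for spurious reasons. In the two assumptions on the sample it expresses
  that the block counts are random variables; no structure on the type of values is needed for this.
\<close>

definition tendsto_in_prob ::
    "'w measure \<Rightarrow> (nat \<Rightarrow> 'w \<Rightarrow> real) \<Rightarrow> ('w \<Rightarrow> real) \<Rightarrow> bool" where
  "tendsto_in_prob M Y Z \<longleftrightarrow>
     (\<forall>n. Y n \<in> borel_measurable M) \<and> Z \<in> borel_measurable M \<and>
     (\<forall>\<epsilon>>0. (\<lambda>n. measure M {\<omega> \<in> space M. \<bar>Y n \<omega> - Z \<omega>\<bar> > \<epsilon>}) \<longlonglongrightarrow> 0)"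

abbreviation little_op1 :: "'w measure \<Rightarrow> (nat \<Rightarrow> 'w \<Rightarrow> real) \<Rightarrow> bool" where
  "little_op1 M Y \<equiv> tendsto_in_prob M Y (\<lambda>_. 0)"

definition big_Op1 :: "'w measure \<Rightarrow> (nat \<Rightarrow> 'w \<Rightarrow> real) \<Rightarrow> bool" where
  "big_Op1 M Y \<longleftrightarrow>
     (\<forall>n. Y n \<in> borel_measurable M) \<and>
     (\<forall>\<epsilon>>0. \<exists>B. \<forall>n. measure M {\<omega> \<in> space M. \<bar>Y n \<omega>\<bar> > B} \<le> \<epsilon>)"

text \<open>The sample of size \<open>n\<close> is \<open>(X 0 \<omega>, \<dots>, X (n - 1) \<omega>)\<close>.\<close>

definition sample :: "(nat \<Rightarrow> 'w \<Rightarrow> 'x) \<Rightarrow> nat \<Rightarrow> 'w \<Rightarrow> 'x list" where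
  "sample X n \<omega> = map (\<lambda>i. X i \<omega>) [0..<n]"

text \<open>
  The multiplicities of the distinct values. The order in which \<^const>\<open>remdups\<close> lists these values is
  immaterial: everything below is symmetric in the block sizes.
\<close>

definition block_sizes :: "(nat \<Rightarrow> 'w \<Rightarrow> 'x) \<Rightarrow> nat \<Rightarrow> 'w \<Rightarrow> nat list" where
  "block_sizes X n \<omega> = (let xs = sample X n \<omega> in map (count_list xs) (remdups xs))"

definition num_blocks :: "(nat \<Rightarrow> 'w \<Rightarrow> 'x) \<Rightarrow> nat \<Rightarrow> 'w \<Rightarrow> nat" where
  "num_blocks X n \<omega> = length (block_sizes X n \<omega>)"

definition num_blocks_of_size :: "(nat \<Rightarrow> 'w \<Rightarrow> 'x) \<Rightarrow> nat \<Rightarrow> nat \<Rightarrow> 'w \<Rightarrow> nat" where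
  "num_blocks_of_size X r n \<omega> = count_list (block_sizes X n \<omega>) r"

definition ep_lik :: "real \<Rightarrow> real \<Rightarrow> nat list \<Rightarrow> real" where
  "ep_lik \<alpha> \<theta> ns =
     (\<Prod>i = 1..<length ns. \<theta> + real i * \<alpha>) / pochhammer (\<theta> + 1) (sum_list ns - 1)
       * (\<Prod>m\<leftarrow>ns. pochhammer (1 - \<alpha>) (m - 1))"

definition ep_param :: "real \<times> real \<Rightarrow> bool" where
  "ep_param = (\<lambda>(\<alpha>, \<theta>). 0 < \<alpha> \<and> \<alpha> < 1 \<and> - \<alpha> < \<theta>)"

definition ep_mle :: "nat list \<Rightarrow> real \<times> real \<Rightarrow> bool" where
  "ep_mle ns = is_arg_max (\<lambda>(\<alpha>, \<theta>). ep_lik \<alpha> \<theta> ns) ep_param"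

definition slowly_varying :: "(real \<Rightarrow> real) \<Rightarrow> bool" where
  "slowly_varying L \<longleftrightarrow>
     (\<forall>x>0. L x \<ge> 0) \<and> (\<forall>a>0. ((\<lambda>x. L (a * x) / L x) \<longlongrightarrow> 1) at_top)"

definition assumption_A ::
    "'w measure \<Rightarrow> (nat \<Rightarrow> 'w \<Rightarrow> 'x) \<Rightarrow> ('w \<Rightarrow> real) \<Rightarrow> real \<Rightarrow> (real \<Rightarrow> real) \<Rightarrow> bool" where
  "assumption_A M X C \<gamma> L \<longleftrightarrow>
     C \<in> borel_measurable M \<and> (AE \<omega> in M. 0 < C \<omega>) \<and>
     0 < \<gamma> \<and> \<gamma> < 1 \<and> slowly_varying L \<and>
     tendsto_in_prob M
       (\<lambda>n \<omega>. real (num_blocks X n \<omega>) / (real n powr \<gamma> * L (real n))) C"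

text \<open>A mass function on the positive integers is a \<^typ>\<open>nat pmf\<close> that does not charge \<open>0\<close>.\<close>

definition assumption_B ::
    "'w measure \<Rightarrow> (nat \<Rightarrow> 'w \<Rightarrow> 'x) \<Rightarrow> nat pmf \<Rightarrow> bool" where
  "assumption_B M X p \<longleftrightarrow>
     pmf p 0 = 0 \<and>
     (\<lambda>r. pmf p r * ln (real r)) summable_on {2..} \<and>
     (\<forall>r\<ge>1. tendsto_in_prob M
        (\<lambda>n \<omega>. real (num_blocks_of_size X r n \<omega>) / real (num_blocks X n \<omega>)) (\<lambda>_. pmf p r)) \<and>
     little_op1 M
       (\<lambda>n \<omega>. ln (real n) *
          (\<Sum>\<^sub>\<infinity>r\<in>{2..}. \<bar>real (num_blocks_of_size X r n \<omega>) / real (num_blocks X n \<omega>) - pmf p r\<bar>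
             * ln (real r)))"

definition alpha_equation :: "nat pmf \<Rightarrow> real \<Rightarrow> bool" where
  "alpha_equation p a \<longleftrightarrow>
     1 / a = (\<Sum>\<^sub>\<infinity>r\<in>{2..}. pmf p r * (\<Sum>i = 1..r - 1. 1 / (real i - a)))"

end

theory Submission
  imports Defs "HOL-Real_Asymp.Real_Asymp"
begin

text \<open>
  A maximiser is a critical point of the log-likelihood. With \<open>k\<close> blocks in a sample of size \<open>n\<close>, the
  \<open>\<theta>\<close>-equation reads \<open>\<Sum>\<^sub>j\<^sub><\<^sub>k 1/(\<theta> + j\<alpha>) = \<Sum>\<^sub>j\<^sub><\<^sub>n 1/(\<theta> + j)\<close>. Comparing both sums with logarithms gives
  \<open>\<theta>\<^bsup>1-\<alpha>\<^esup> \<approx> \<alpha> k n\<^bsup>-\<alpha>\<^esup>\<close> when \<open>\<theta>\<close> is large, forces \<open>\<theta>\<close> to stay bounded when \<open>k n\<^bsup>-\<alpha>\<^esup>\<close> is bounded, and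
  makes the first summand \<open>1/(\<theta> + \<alpha>)\<close> explode when \<open>k n\<^bsup>-\<alpha>\<^esup> \<longlongrightarrow> 0\<close>. In each case \<open>\<theta>\<close> is smaller than \<open>k\<close> by a
  power of \<open>n\<close>, so the \<open>\<alpha>\<close>-equation, divided by \<open>k\<close>, is \<open>\<alpha> g(\<alpha>) = 1 + o(1 / log n)\<close> with \<open>g\<close> the
  right-hand side of the equation for the limit. Since \<open>\<alpha> g(\<alpha>)\<close> has slope bounded below, this yields
  \<open>(\<alpha> - \<alpha>\<^sup>*) log n \<longlongrightarrow> 0\<close>, which is what is needed to replace \<open>n\<^bsup>\<alpha>\<^esup>\<close> by the same power with exponent \<open>\<alpha>\<^sup>*\<close>.
  Only the critical equations are used, so no likelihood values have to be compared.

  Convergence in probability is turned into convergence along a filter on pairs of a sample size and an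
  outcome; all estimates are then deterministic.
\<close>

subsection \<open>Sums of reciprocals in arithmetic progressions\<close>

text \<open>The two unknowns are coupled: a power bound on \<theta> needs \<alpha> in a compact part
  of the unit interval, and confining \<alpha> needs \<theta> small compared with k. The link is
  \<open>\<theta> * S + \<alpha> * H = k - 1\<close>, the sum of the critical equations with weights
  \<theta> and \<alpha>, where S is the right-hand side of the \<theta>-equation. As
  \<open>\<alpha> * H\<close> is nonnegative and n / k tends to infinity, it yields
  \<open>\<theta> \<le> \<delta> * k\<close> for every positive \<delta> without any information on
  \<alpha>. This breaks the circle: the crude bound confines \<alpha>, and only then does \<theta>
  drop below k by a power of n. The rate o(1 / log n) originates in the factor log n of Assumption
  (B): the summands of the \<alpha>-equation grow at most like log r, so the weighted sum in (B)
  dominates its error. Negative \<theta> is admissible down to -\<alpha>, so estimates that need a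
  positive \<theta> have companions that assume only \<open>0 < \<theta> + \<alpha>\<close>.\<close>

lemma sum_inverse_lower:
  fixes x a :: real
  assumes "0 < a" "0 < x + a" "1 \<le> m"
  shows "ln ((x + real m * a) / (x + a)) / a \<le> (\<Sum>j=1..<m. 1 / (x + real j * a))"
  using assms(3)
proof (induction m rule: dec_induct)
  case base
  show ?case using assms by simp
next
  case (step m)
  have "1 * a \<le> real m * a"
    using assms step by (intro mult_right_mono) auto
  then have p: "0 < x + real m * a"
    using assms by linarith
  then have p': "0 < x + real (Suc m) * a"
    using assms by (simp add: algebra_simps)
  \<comment> \<open>The inequality \<open>ln y \<le> y - 1\<close> bounds the increment of the
    logarithm by a times the new summand; applied to the inverse quotient it gives the opposite
    bound in the next lemma.\<close>
  have "ln ((x + real (Suc m) * a) / (x + real m * a)) \<le> (x + real (Suc m) * a) / (x + real m * a) - 1"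
    using p p' by (intro ln_le_minus_one) simp
  also have "\<dots> = a / (x + real m * a)"
    using p by (simp add: field_simps)
  finally have "ln ((x + real (Suc m) * a) / (x + a)) \<le> ln ((x + real m * a) / (x + a)) + a / (x + real m * a)"
    using p p' assms by (simp add: ln_div)
  then have "ln ((x + real (Suc m) * a) / (x + a)) / a
      \<le> (ln ((x + real m * a) / (x + a)) + a / (x + real m * a)) / a"
    using assms(1) by (intro divide_right_mono) auto
  also have "\<dots> = ln ((x + real m * a) / (x + a)) / a + 1 / (x + real m * a)"
    using assms(1) by (simp only: add_divide_distrib) simp
  finally show ?case using step by simp
qed

text \<open>The summand with index j is compared with the increment of the logarithm over the step
  that ends at \<open>x + j * a\<close>. The first comparison therefore starts at x itself, which
  must be positive. The bound covers even the summand j = m, which is dropped at the end.\<close>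

lemma sum_inverse_upper:
  fixes x a :: real
  assumes "0 < a" "0 < x"
  shows "(\<Sum>j=1..<m. 1 / (x + real j * a)) \<le> ln ((x + real m * a) / x) / a"
proof -
  have *: "(\<Sum>j=1..<Suc m. 1 / (x + real j * a)) \<le> ln ((x + real m * a) / x) / a" for m
  proof (induction m)
    case 0
    show ?case using assms by simp
  next
    case (Suc m)
    have p: "0 < x + real m * a" and p': "0 < x + real (Suc m) * a"
      using assms by (auto intro: add_pos_nonneg)
    have "ln ((x + real m * a) / (x + real (Suc m) * a)) \<le> (x + real m * a) / (x + real (Suc m) * a) - 1"
      using p p' by (intro ln_le_minus_one) simp
    also have "\<dots> = - a / (x + real (Suc m) * a)"
      using p' by (simp add: field_simps)
    finally have "ln ((x + real (Suc m) * a) / x) \<ge> ln ((x + real m * a) / x) + a / (x + real (Suc m) * a)"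
      using p p' assms by (simp add: ln_div)
    then have "(ln ((x + real m * a) / x) + a / (x + real (Suc m) * a)) / a \<le> ln ((x + real (Suc m) * a) / x) / a"
      using assms(1) by (intro divide_right_mono) auto
    then have "ln ((x + real m * a) / x) / a + 1 / (x + real (Suc m) * a) \<le> ln ((x + real (Suc m) * a) / x) / a"
      using assms(1) by (simp only: add_divide_distrib) simp
    then show ?case using Suc by simp
  qed
  have "(\<Sum>j=1..<m. 1 / (x + real j * a)) \<le> (\<Sum>j=1..<Suc m. 1 / (x + real j * a))"
    using assms by (intro sum_mono2) (auto intro!: add_nonneg_nonneg)
  also note *
  finally show ?thesis .
qed

text \<open>For x close to -a the first summand is arbitrarily large and is kept apart; the later
  ones have denominators above \<open>j * a\<close> and are dominated by a harmonic sum. The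
  convergence of \<theta> to the boundary is read off the isolated summand.\<close>

lemma sum_inverse_upper':
  fixes x a :: real
  assumes "0 < a" "0 < x + a" "1 \<le> m"
  shows "(\<Sum>j=1..<m. 1 / (x + real j * a)) \<le> 1 / (x + a) + (1 + ln (real m)) / a"
proof (cases "m = 1")
  case True
  then show ?thesis using assms by simp
next
  case False
  have h: "(\<Sum>j=1..<Suc m. 1 / real j) \<le> 1 + ln (real m)"
  proof -
    \<comment> \<open>Harmonic number minus logarithm decreases from its value 1 at index 1.\<close>
    have "harm (Suc (m - 1)) - ln (real (Suc (m - 1))) \<le> harm (Suc 0) - ln (real (Suc 0))"
      using decseq_harm_diff_ln by (auto simp only: decseq_def le0)
    then show ?thesis
      using assms(3) by (simp add: harm_def inverse_eq_divide atLeastLessThanSuc_atLeastAtMost)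
  qed
  have "(\<Sum>j=1..<m. 1 / (x + real j * a)) = 1 / (x + a) + (\<Sum>j=Suc 1..<m. 1 / (x + real j * a))"
    using False assms(3) by (subst sum.atLeast_Suc_lessThan) auto
  also have "(\<Sum>j=Suc 1..<m. 1 / (x + real j * a)) = (\<Sum>j=1..<m - 1. 1 / (x + real (Suc j) * a))"
    using False assms(3) sum.shift_bounds_Suc_ivl[of "\<lambda>j. 1 / (x + real j * a)" 1 "m - 1"] by simp
  also have "\<dots> \<le> (\<Sum>j=1..<m - 1. (1 / real j) / a)"
  proof (intro sum_mono)
    fix j assume "j \<in> {1..<m - 1}"
    then have "0 < real j * a" using assms by auto
    then show "1 / (x + real (Suc j) * a) \<le> (1 / real j) / a"
      using assms by (simp add: divide_simps) (auto simp: algebra_simps)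
  qed
  also have "\<dots> = (\<Sum>j=1..<m - 1. (1 / real j)) / a"
    by (simp add: sum_divide_distrib)
  also have "\<dots> \<le> (1 + ln (real m)) / a"
  proof (intro divide_right_mono)
    have "(\<Sum>j=1..<m - 1. (1 / real j)) \<le> (\<Sum>j=1..<Suc m. (1 / real j))"
      by (intro sum_mono2) auto
    then show "(\<Sum>j=1..<m - 1. (1 / real j)) \<le> 1 + ln (real m)" using h by linarith
  qed (use assms in auto)
  finally show ?thesis by simp
qed

lemma weighted_sum_split:
  fixes x a :: real
  assumes "0 < a" "0 < x + a" "1 \<le> m"
  shows "x * (\<Sum>j=1..<m. 1 / (x + real j * a)) + a * (\<Sum>j=1..<m. real j / (x + real j * a)) = real m - 1"
proof -
  have "x * (\<Sum>j=1..<m. 1 / (x + real j * a)) + a * (\<Sum>j=1..<m. real j / (x + real j * a))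
     = (\<Sum>j=1..<m. (x + real j * a) / (x + real j * a))"
    unfolding sum_distrib_left sum.distrib[symmetric]
    by (intro sum.cong refl) (simp only: add_divide_distrib times_divide_eq_right mult_1_right mult.commute[of a])
  also have "\<dots> = (\<Sum>j=1..<m. 1)"
  proof (intro sum.cong refl)
    fix j assume "j \<in> {1..<m}"
    then have "a \<le> real j * a" using assms by auto
    then have "x + real j * a \<noteq> 0" using assms by linarith
    then show "(x + real j * a) / (x + real j * a) = 1" by simp
  qed
  finally show ?thesis using assms by (simp add: of_nat_diff)
qed

text \<open>All denominators are replaced by a common upper bound, where \<open>max x 0\<close>
  accounts for negative x. This makes the left side of the \<alpha>-equation large when \<theta> / k
  and \<alpha> are both small.\<close>

lemma weighted_sum_lower:
  fixes x a :: real
  assumes "0 < a" "0 < x + a" "1 \<le> m"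
  shows "(real m - 1) * real m / (2 * (max x 0 + real m * a)) \<le> (\<Sum>j=1..<m. real j / (x + real j * a))"
proof -
  have g: "(\<Sum>j=1..<m. real j) = (real m - 1) * real m / 2"
    using assms(3) by (induction m rule: dec_induct) (auto simp: field_simps)
  have "(real m - 1) * real m / (2 * (max x 0 + real m * a)) = (\<Sum>j=1..<m. real j) / (max x 0 + real m * a)"
    unfolding g by simp
  also have "\<dots> = (\<Sum>j=1..<m. real j / (max x 0 + real m * a))"
    by (simp add: sum_divide_distrib)
  also have "\<dots> \<le> (\<Sum>j=1..<m. real j / (x + real j * a))"
  proof (intro sum_mono divide_left_mono)
    fix j assume j: "j \<in> {1..<m}"
    then have "a \<le> real j * a" "real j * a \<le> real m * a" using assms by auto
    then have "x + real j * a \<le> max x 0 + real m * a" "0 < x + real j * a"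
      using assms by linarith+
    then show "x + real j * a \<le> max x 0 + real m * a" "0 < (max x 0 + real m * a) * (x + real j * a)"
      by (auto intro!: mult_pos_pos)
  qed auto
  finally show ?thesis .
qed

text \<open>Each \<open>x / (x + j)\<close> increases in x although \<open>1 / (x + j)\<close>
  decreases. Hence a large \<theta> can be lowered to a threshold in the product
  \<open>\<theta> * S\<close>.\<close>

lemma product_sum_mono:
  fixes x y :: real
  assumes "0 < y" "y \<le> x"
  shows "y * (\<Sum>j=1..<m. 1 / (y + real j)) \<le> x * (\<Sum>j=1..<m. 1 / (x + real j))"
  unfolding sum_distrib_left
proof (intro sum_mono)
  fix j
  have "1 - real j / (y + real j) \<le> 1 - real j / (x + real j)"
    using assms by (intro diff_mono divide_left_mono mult_pos_pos) auto
  moreover have "y * (1 / (y + real j)) = 1 - real j / (y + real j)"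
     "x * (1 / (x + real j)) = 1 - real j / (x + real j)"
    using assms by (simp_all add: field_simps)
  ultimately show "y * (1 / (y + real j)) \<le> x * (1 / (x + real j))"
    by simp
qed

subsection \<open>Asymptotics of the critical equations along a filter\<close>

text \<open>
  \<open>H\<close> is the data side of the \<open>\<alpha>\<close>-equation, \<open>g\<close> the limit of \<open>H / k\<close> and \<open>D\<close> a bound for the
  distance between the two. \<open>Q\<close> is the proportion of blocks of some fixed size at least two that has positive
  limiting frequency \<open>q\<close>; it keeps \<open>\<alpha>\<close> away from 1.
\<close>

locale ep_critical =
  fixes F :: "'i filter" and n k :: "'i \<Rightarrow> nat" and \<alpha> \<theta> H D Q :: "'i \<Rightarrow> real"
    and g :: "real \<Rightarrow> real" and \<gamma> \<alpha>s q c :: real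
  assumes n_top: "filterlim n at_top F"
    and \<gamma>: "0 < \<gamma>" "\<gamma> < 1"
    and lnk: "((\<lambda>i. ln (real (k i)) / ln (real (n i))) \<longlongrightarrow> \<gamma>) F"
    and \<alpha>s: "0 < \<alpha>s" "\<alpha>s < 1" "\<alpha>s * g \<alpha>s = 1"
    and q: "0 < q"
    and g_mono: "\<And>a b. 0 < a \<Longrightarrow> a \<le> b \<Longrightarrow> b < 1 \<Longrightarrow> g a \<le> g b"
    and g_ge: "\<And>a. 0 < a \<Longrightarrow> a < 1 \<Longrightarrow> q \<le> g a"
    and D: "((\<lambda>i. ln (real (n i)) * D i) \<longlongrightarrow> 0) F"
    and Q: "(Q \<longlongrightarrow> q) F"
    and param: "\<forall>\<^sub>F i in F. 0 < \<alpha> i \<and> \<alpha> i < 1 \<and> - \<alpha> i < \<theta> i"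
    and eq_\<theta>: "\<forall>\<^sub>F i in F. (\<Sum>j=1..<k i. 1 / (\<theta> i + real j * \<alpha> i)) = (\<Sum>j=1..<n i. 1 / (\<theta> i + real j))"
    and eq_\<alpha>: "\<forall>\<^sub>F i in F. (\<Sum>j=1..<k i. real j / (\<theta> i + real j * \<alpha> i)) = H i"
    and H_g: "\<forall>\<^sub>F i in F. \<bar>H i / real (k i) - g (\<alpha> i)\<bar> \<le> c * D i / (1 - \<alpha> i)"
    and H_Q: "\<forall>\<^sub>F i in F. Q i / (1 - \<alpha> i) \<le> H i / real (k i)"
begin

section \<open>Growth of \<open>n\<close> and \<open>k\<close> along the filter\<close>

lemma real_n_top: "filterlim (\<lambda>i. real (n i)) at_top F"
  using filterlim_compose[OF filterlim_real_sequentially n_top] .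

lemma ln_n_top: "filterlim (\<lambda>i. ln (real (n i))) at_top F"
  using filterlim_compose[OF ln_at_top real_n_top] .

lemma ev_ln_n: "\<forall>\<^sub>F i in F. B \<le> ln (real (n i))"
  using ln_n_top by (simp add: filterlim_at_top)

lemma ev_n: "\<forall>\<^sub>F i in F. B \<le> real (n i)"
  using real_n_top by (simp add: filterlim_at_top)

lemma ln_k_top: "filterlim (\<lambda>i. ln (real (k i))) at_top F"
proof -
  have "filterlim (\<lambda>i. ln (real (k i)) / ln (real (n i)) * ln (real (n i))) at_top F"
    by (rule filterlim_tendsto_pos_mult_at_top[OF lnk \<gamma>(1) ln_n_top])
  then show ?thesis
    by (rule filterlim_mono_eventually) (use ev_ln_n[of 1] in \<open>auto elim!: eventually_mono\<close>)
qed

lemma k_top: "filterlim (\<lambda>i. real (k i)) at_top F"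
proof -
  have "\<forall>\<^sub>F i in F. 1 \<le> ln (real (k i))"
    using ln_k_top by (simp add: filterlim_at_top)
  then have "\<forall>\<^sub>F i in F. exp (ln (real (k i))) = real (k i)"
    \<comment> \<open>Since \<open>ln 0 = 0\<close>, a logarithm of at least 1 excludes
      \<open>k i = 0\<close>.\<close>
    by eventually_elim (metis exp_ln ln_0 not_one_le_zero of_nat_0_less_iff of_nat_0_eq_iff gr0I)
  from filterlim_cong[OF refl refl this] filterlim_compose[OF exp_at_top ln_k_top] show ?thesis
    by simp
qed

lemma ev_k: "\<forall>\<^sub>F i in F. B \<le> real (k i)"
  using k_top by (simp add: filterlim_at_top)

lemma ev_ln_k_ge: "\<forall>\<^sub>F i in F. \<gamma> / 2 * ln (real (n i)) \<le> ln (real (k i))"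
proof -
  have "\<forall>\<^sub>F i in F. \<gamma> / 2 < ln (real (k i)) / ln (real (n i))"
    using \<gamma> by (intro order_tendstoD(1)[OF lnk]) auto
  with ev_ln_n[of 1] show ?thesis
    by eventually_elim (simp add: field_simps)
qed

lemma ev_ln_k_le: "\<forall>\<^sub>F i in F. (1 - \<gamma>) / 2 * ln (real (n i)) \<le> ln (real (n i)) - ln (real (k i))"
proof -
  have "\<forall>\<^sub>F i in F. ln (real (k i)) / ln (real (n i)) < (1 + \<gamma>) / 2"
    using \<gamma> by (intro order_tendstoD(2)[OF lnk]) auto
  with ev_ln_n[of 1] show ?thesis
    by eventually_elim (simp add: field_simps)
qed

text \<open>Eventually k is at least n to the power \<gamma> / 2. The square prepares for the rate
  of \<alpha>: one logarithm comes from the bound on \<open>S\<close>, the other from the rate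
  itself.\<close>

lemma log_over_k: "((\<lambda>i. (1 + ln (real (n i)))\<^sup>2 / real (k i)) \<longlongrightarrow> 0) F"
proof (rule Lim_null_comparison)
  have "((\<lambda>x. (1 + x)\<^sup>2 * exp (- (\<gamma> / 2) * x)) \<longlongrightarrow> 0) at_top"
    using \<gamma>(1) by real_asymp
  then show "((\<lambda>i. (1 + ln (real (n i)))\<^sup>2 * exp (- (\<gamma> / 2) * ln (real (n i)))) \<longlongrightarrow> 0) F"
    by (rule filterlim_compose[OF _ ln_n_top])
  show "\<forall>\<^sub>F i in F. norm ((1 + ln (real (n i)))\<^sup>2 / real (k i)) \<le> (1 + ln (real (n i)))\<^sup>2 * exp (- (\<gamma> / 2) * ln (real (n i)))"
    using ev_ln_k_ge ev_k[of 1]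
  proof eventually_elim
    case (elim i)
    have "exp (\<gamma> / 2 * ln (real (n i))) \<le> exp (ln (real (k i)))"
      using elim by (simp only: exp_le_cancel_iff)
    then have "exp (\<gamma> / 2 * ln (real (n i))) \<le> real (k i)"
      using elim by simp
    then have "1 / real (k i) \<le> 1 / exp (\<gamma> / 2 * ln (real (n i)))"
      using elim by (intro divide_left_mono) auto
    then have "(1 + ln (real (n i)))\<^sup>2 * (1 / real (k i)) \<le> (1 + ln (real (n i)))\<^sup>2 * (1 / exp (\<gamma> / 2 * ln (real (n i))))"
      by (intro mult_left_mono) auto
    then show ?case by (simp add: exp_minus field_simps)
  qed
qed

lemma n_over_k_top: "filterlim (\<lambda>i. real (n i) / real (k i)) at_top F"
proof (rule filterlim_at_top_mono)
  have "filterlim (\<lambda>x. exp ((1 - \<gamma>) / 2 * x)) at_top at_top"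
    using \<gamma> by real_asymp
  then show "filterlim (\<lambda>i. exp ((1 - \<gamma>) / 2 * ln (real (n i)))) at_top F"
    by (rule filterlim_compose[OF _ ln_n_top])
  show "\<forall>\<^sub>F i in F. exp ((1 - \<gamma>) / 2 * ln (real (n i))) \<le> real (n i) / real (k i)"
    using ev_ln_k_le ev_k[of 1] ev_n[of 1]
  proof eventually_elim
    case (elim i)
    have "exp ((1 - \<gamma>) / 2 * ln (real (n i))) \<le> exp (ln (real (n i)) - ln (real (k i)))"
      using elim by simp
    also have "\<dots> = real (n i) / real (k i)"
      using elim by (simp add: exp_diff)
    finally show ?case .
  qed
qed

lemma Q_pos: "\<forall>\<^sub>F i in F. q / 2 \<le> Q i"
proof -
  have "\<forall>\<^sub>F i in F. q / 2 < Q i"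
    using q by (intro order_tendstoD(1)[OF Q]) auto
  then show ?thesis by eventually_elim simp
qed

lemma D_0: "(D \<longlongrightarrow> 0) F"
proof -
  have "((\<lambda>i. ln (real (n i)) * D i / ln (real (n i))) \<longlongrightarrow> 0) F"
    by (rule real_tendsto_divide_at_top[OF D ln_n_top])
  then show ?thesis
    by (rule Lim_transform_eventually) (use ev_ln_n[of 1] in \<open>eventually_elim, auto\<close>)
qed

section \<open>A priori bounds on both parameters\<close>

abbreviation "S i \<equiv> \<Sum>j=1..<n i. 1 / (\<theta> i + real j)"

text \<open>The bounds on \<open>S\<close> hold for every admissible \<theta> because
  \<open>\<theta> + 1 > 1 - \<alpha>\<close>. The identity is \<open>weighted_sum_split\<close> with
  step \<alpha>, after both critical equations have been inserted.\<close>

lemma ev_S: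
  "\<forall>\<^sub>F i in F. ln ((\<theta> i + real (n i)) / (\<theta> i + 1)) \<le> S i \<and>
     S i \<le> 1 / (1 - \<alpha> i) + 1 + ln (real (n i)) \<and> 0 \<le> S i \<and>
     \<theta> i * S i + \<alpha> i * H i = real (k i) - 1 \<and> 0 \<le> H i"
  using param eq_\<theta> eq_\<alpha> ev_k[of 1] ev_n[of 1] Q_pos H_Q
proof eventually_elim
  case (elim i)
  have t: "0 < 1 - \<alpha> i" "1 - \<alpha> i < \<theta> i + 1" "1 \<le> n i" "1 \<le> k i"
    using elim by auto
  have "S i \<le> 1 / (\<theta> i + 1) + 1 + ln (real (n i))"
    using sum_inverse_upper'[of 1 "\<theta> i" "n i"] t by simp
  moreover have "1 / (\<theta> i + 1) \<le> 1 / (1 - \<alpha> i)"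
    using t by (intro divide_left_mono) auto
  moreover have "0 \<le> S i"
    using t by (intro sum_nonneg) (auto intro!: divide_nonneg_nonneg)
  moreover have "\<theta> i * S i + \<alpha> i * H i = real (k i) - 1"
    using weighted_sum_split[of "\<alpha> i" "\<theta> i" "k i"] elim t by simp
  moreover have "0 \<le> H i"
  proof -
    have "0 \<le> Q i / (1 - \<alpha> i)" using elim q t by auto
    then have "0 \<le> H i / real (k i)" using elim by linarith
    then show ?thesis using elim by (simp add: zero_le_divide_iff)
  qed
  moreover have "ln ((\<theta> i + real (n i)) / (\<theta> i + 1)) \<le> S i"
    using sum_inverse_lower[of 1 "\<theta> i" "n i"] t by simp
  ultimately show ?case by auto
qed

text \<open>If \<theta> exceeded \<open>\<delta> * k\<close>, then \<open>\<theta> * S\<close> would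
  be at least \<open>\<delta> * k\<close> times a logarithm of order log (n / k), which is
  unbounded, whereas the identity in \<open>ev_S\<close> gives
  \<open>\<theta> * S \<le> k - 1\<close>.\<close>

lemma ev_\<theta>_le:
  assumes "0 < \<delta>"
  shows "\<forall>\<^sub>F i in F. \<theta> i \<le> \<delta> * real (k i)"
proof -
  have "\<forall>\<^sub>F i in F. exp (1 / \<delta>) * (\<delta> + 1) \<le> real (n i) / real (k i)"
    using n_over_k_top by (simp add: filterlim_at_top)
  with ev_S ev_k[of 1] ev_n[of 1] param show ?thesis
  proof eventually_elim
    case (elim i)
    show ?case
    proof (rule ccontr)
      assume "\<not> \<theta> i \<le> \<delta> * real (k i)"
      moreover define y where "y = \<delta> * real (k i)"
      ultimately have y: "y < \<theta> i" "0 < y" "1 \<le> real (k i)" "1 \<le> n i"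
        using elim assms by auto
      have "\<delta> * real (k i) * ln ((y + real (n i)) / (y + 1)) \<le> y * (\<Sum>j=1..<n i. 1 / (y + real j))"
        unfolding y_def[symmetric]
        using sum_inverse_lower[of 1 y "n i"] y by (intro mult_left_mono) auto
      also have "\<dots> \<le> \<theta> i * S i"
        using y by (intro product_sum_mono) auto
      also have "\<dots> \<le> real (k i) - 1"
        using elim mult_nonneg_nonneg[of "\<alpha> i" "H i"] by linarith
      also have "\<dots> < real (k i)" by simp
      finally have "real (k i) * (\<delta> * ln ((y + real (n i)) / (y + 1))) < real (k i) * 1"
        by (simp add: mult.assoc mult.left_commute)
      then have "\<delta> * ln ((y + real (n i)) / (y + 1)) < 1"
        using y by (simp only: mult_less_cancel_left_pos)
      then have "ln ((y + real (n i)) / (y + 1)) < 1 / \<delta>"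
        using assms by (simp add: field_simps)
      then have "exp (ln ((y + real (n i)) / (y + 1))) < exp (1 / \<delta>)"
        by simp
      moreover have "0 < (y + real (n i)) / (y + 1)"
        using y by (intro divide_pos_pos) auto
      ultimately have "(y + real (n i)) / (y + 1) < exp (1 / \<delta>)"
        by simp
      moreover have "real (n i) / ((\<delta> + 1) * real (k i)) \<le> (y + real (n i)) / (y + 1)"
      proof (intro frac_le)
        show "y + 1 \<le> (\<delta> + 1) * real (k i)"
          using y(3) by (simp add: y_def algebra_simps)
      qed (use y in auto)
      ultimately have "real (n i) / real (k i) / (\<delta> + 1) < exp (1 / \<delta>)"
        by (simp only: divide_divide_eq_left mult.commute[of "\<delta> + 1"])
      then have "real (n i) / real (k i) < exp (1 / \<delta>) * (\<delta> + 1)"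
        using assms by (subst (asm) pos_divide_less_eq) auto
      then show False using elim by linarith
    qed
  qed
qed

text \<open>A small \<alpha> makes every \<open>\<theta> + j * \<alpha>\<close> small compared with
  k, so the \<alpha>-equation pushes H above any given multiple of k. But
  \<open>H \<le> G * k\<close> for \<open>\<alpha> \<le> 1/2\<close>, because g is monotone and D
  tends to 0.\<close>

lemma \<alpha>_bounded_below: "\<exists>a>0. \<forall>\<^sub>F i in F. a \<le> \<alpha> i"
proof -
  define G where "G = g (1/2) + 1"
  have G: "1 < G" using g_ge[of "1/2"] q by (simp add: G_def)
  \<comment> \<open>With the same factor 8 in the bound on \<theta> one gets
    \<open>T < k / (4 * G)\<close>, hence \<open>k - 1 < k / 2\<close>, which is impossible for k at
    least 2.\<close>
  define a where "a = min (1/2) (1 / (8 * G))"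
  have "((\<lambda>i. \<bar>2 * (c * D i)\<bar>) \<longlongrightarrow> 0) F"
    by (rule tendsto_eq_intros D_0 | simp)+
  then have "\<forall>\<^sub>F i in F. \<bar>2 * (c * D i)\<bar> < 1"
    by (rule order_tendstoD) simp
  moreover have "\<forall>\<^sub>F i in F. \<theta> i \<le> 1 / (8 * G) * real (k i)"
    using G by (intro ev_\<theta>_le) auto
  ultimately have "\<forall>\<^sub>F i in F. a \<le> \<alpha> i"
    using param eq_\<alpha> H_g ev_k[of 2]
  proof eventually_elim
    case (elim i)
    show ?case
    proof (rule ccontr)
      assume *: "\<not> a \<le> \<alpha> i"
      then have le: "\<alpha> i \<le> 1/2" "\<alpha> i < 1 / (8 * G)" by (auto simp: a_def)
      have "c * D i / (1 - \<alpha> i) \<le> \<bar>c * D i\<bar> / (1/2)"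
        using le by (intro frac_le) auto
      moreover have "g (\<alpha> i) \<le> g (1/2)"
        using le elim by (intro g_mono) auto
      ultimately have "H i / real (k i) \<le> G"
        using elim unfolding G_def by auto
      then have HG: "H i \<le> G * real (k i)"
        using elim by (simp add: field_simps)
      define T where "T = max (\<theta> i) 0 + real (k i) * \<alpha> i"
      have T: "0 < T" using elim by (auto simp: T_def intro!: add_nonneg_pos)
      have "(real (k i) - 1) * real (k i) / (2 * T) \<le> H i"
        using weighted_sum_lower[of "\<alpha> i" "\<theta> i" "k i"] elim unfolding T_def by auto
      also note HG
      finally have "(real (k i) - 1) * real (k i) \<le> G * (2 * T) * real (k i)"
        using T by (simp add: field_simps)
      then have "real (k i) - 1 \<le> G * (2 * T)"
        by (rule mult_right_le_imp_le) (use elim in auto)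
      moreover have "T < 1 / (8 * G) * real (k i) + real (k i) * (1 / (8 * G))"
        unfolding T_def using elim le G by (intro add_le_less_mono mult_strict_left_mono) auto
      then have "T < real (k i) / (4 * G)" by (simp add: field_simps)
      then have "G * (2 * T) < real (k i) / 2"
        using G by (simp add: field_simps)
      ultimately show False using elim by auto
    qed
  qed
  moreover have "0 < a" using G by (auto simp: a_def)
  ultimately show ?thesis by blast
qed

lemma log1_over_k: "((\<lambda>i. (1 + ln (real (n i))) / real (k i)) \<longlongrightarrow> 0) F"
proof (rule Lim_null_comparison[OF _ log_over_k])
  show "\<forall>\<^sub>F i in F. norm ((1 + ln (real (n i))) / real (k i)) \<le> (1 + ln (real (n i)))\<^sup>2 / real (k i)"
    using ev_ln_n[of 0]
  proof eventually_elim
    case (elim i)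
    have "(1 + ln (real (n i))) * 1 \<le> (1 + ln (real (n i))) * (1 + ln (real (n i)))"
      using elim by (intro mult_left_mono) auto
    then show ?case
      using elim by (auto simp: power2_eq_square intro!: divide_right_mono)
  qed
qed

text \<open>The blocks counted by Q force H / k to be at least \<open>Q / (1 - \<alpha>)\<close>,
  while the identity in \<open>ev_S\<close> and \<open>\<theta> > - 1\<close> keep
  \<open>\<alpha> * H\<close> below \<open>k + S\<close>. As \<open>S\<close> is at most 1 / (1 -
  \<alpha>) plus a term of size o(k), multiplying by 1 - \<alpha> leaves a positive lower bound for
  1 - \<alpha>.\<close>

lemma \<alpha>_bounded_above: "\<exists>a<1. \<forall>\<^sub>F i in F. \<alpha> i \<le> a"
proof -
  obtain a0 where a0: "0 < a0" "\<forall>\<^sub>F i in F. a0 \<le> \<alpha> i"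
    using \<alpha>_bounded_below by blast
  have "\<forall>\<^sub>F i in F. (1 + ln (real (n i))) / real (k i) < 1"
    using log1_over_k by (rule order_tendstoD) simp
  with param Q_pos H_Q ev_S a0(2) ev_k[of "8 / (a0 * q)"] ev_k[of 1]
  have "\<forall>\<^sub>F i in F. \<alpha> i \<le> 1 - a0 * q / 8"
  proof eventually_elim
    case (elim i)
    define K where "K = real (k i)"
    define u where "u = 1 - \<alpha> i"
    have K: "0 < K" "8 / (a0 * q) \<le> K" using elim by (auto simp: K_def)
    have u: "0 < u" "u < 1" using elim by (auto simp: u_def)
    have "- \<theta> i * S i \<le> 1 * S i"
      using elim by (intro mult_right_mono) auto
    then have "\<alpha> i * H i \<le> K + (1 / u + 1 + ln (real (n i)))"
      using elim by (auto simp: K_def u_def)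
    then have "\<alpha> i * H i * u \<le> (K + (1 / u + 1 + ln (real (n i)))) * u"
      using u by (intro mult_right_mono) auto
    also have "\<dots> = K * u + 1 + (1 + ln (real (n i))) * u"
      using u by (simp add: field_simps)
    also have "(1 + ln (real (n i))) * u \<le> K * u"
      using elim u K by (intro mult_right_mono) (auto simp: K_def field_simps)
    finally have 1: "\<alpha> i * H i * u \<le> 2 * K * u + 1" by simp
    have "q / 2 * K \<le> H i * u"
    proof -
      have "q / 2 / u \<le> Q i / u" using elim u by (intro divide_right_mono) auto
      also have "\<dots> \<le> H i / K" using elim by (simp add: u_def K_def)
      finally show ?thesis using u K by (simp add: field_simps)
    qed
    then have "a0 * (q / 2 * K) \<le> \<alpha> i * (H i * u)"
      using elim a0 q K u by (intro mult_mono[of a0]) auto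
    with 1 have "a0 * q / 2 * K \<le> 2 * K * u + 1" by (simp add: mult.assoc)
    moreover have "1 \<le> a0 * q / 8 * K" using K(2) a0 q by (simp add: field_simps)
    ultimately have "a0 * q / 8 * 3 * K \<le> 2 * u * K" by (simp add: mult_ac)
    then have "a0 * q / 8 * 3 \<le> 2 * u" using K by simp
    moreover have "0 < a0 * q" using a0 q by simp
    ultimately show ?case unfolding u_def by simp
  qed
  moreover have "1 - a0 * q / 8 < 1" using a0 q by simp
  ultimately show ?thesis by blast
qed

text \<open>This is the upper half of the heuristic for \<theta> to the power 1 - \<alpha>, up to a
  constant factor. Both sums of the \<theta>-equation are replaced by logarithms, with
  \<open>\<theta> + 1 \<le> 2 * \<theta>\<close> and, by \<open>\<theta> \<le> k\<close>,
  \<open>\<theta> + k * \<alpha> \<le> 2 * k\<close>; the constant 2 covers the resulting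
  \<open>(1 + \<alpha>) * ln 2\<close>.\<close>

lemma ev_\<theta>_ln: "\<forall>\<^sub>F i in F. 1 \<le> \<theta> i \<longrightarrow>
   (1 - \<alpha> i) * ln (\<theta> i) \<le> ln (real (k i)) - \<alpha> i * ln (real (n i)) + 2"
  using param eq_\<theta> ev_S ev_k[of 1] ev_n[of 1] ev_\<theta>_le[of 1, simplified]
proof eventually_elim
  case (elim i)
  show ?case
  proof
    assume t: "1 \<le> \<theta> i"
    have "ln (real (n i) / (2 * \<theta> i)) \<le> ln ((\<theta> i + real (n i)) / (\<theta> i + 1))"
    proof -
      have "real (n i) / (2 * \<theta> i) \<le> (\<theta> i + real (n i)) / (\<theta> i + 1)"
        using t by (intro frac_le) auto
      then show ?thesis using t elim by (subst ln_le_cancel_iff) (auto intro!: divide_pos_pos)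
    qed
    also have "\<dots> \<le> S i" using elim by simp
    also have "\<dots> \<le> ln ((\<theta> i + real (k i) * \<alpha> i) / \<theta> i) / \<alpha> i"
      using sum_inverse_upper[of "\<alpha> i" "\<theta> i" "k i"] elim t by simp
    also have "\<dots> \<le> ln ((2 * real (k i)) / \<theta> i) / \<alpha> i"
    proof (intro divide_right_mono)
      have "real (k i) * \<alpha> i \<le> real (k i) * 1"
        using elim by (intro mult_left_mono) auto
      then have "\<theta> i + real (k i) * \<alpha> i \<le> 2 * real (k i)"
        using elim by linarith
      then have "(\<theta> i + real (k i) * \<alpha> i) / \<theta> i \<le> (2 * real (k i)) / \<theta> i"
        using t by (intro divide_right_mono) auto
      then show "ln ((\<theta> i + real (k i) * \<alpha> i) / \<theta> i) \<le> ln ((2 * real (k i)) / \<theta> i)"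
        using t elim by (subst ln_le_cancel_iff) (auto intro!: divide_pos_pos add_pos_nonneg)
    qed (use elim in auto)
    finally have "\<alpha> i * ln (real (n i) / (2 * \<theta> i)) \<le> ln ((2 * real (k i)) / \<theta> i)"
      using elim by (simp add: field_simps)
    then have "\<alpha> i * (ln (real (n i)) - ln 2 - ln (\<theta> i)) \<le> ln 2 + ln (real (k i)) - ln (\<theta> i)"
      using t elim by (simp add: ln_div ln_mult diff_diff_eq)
    moreover have "\<alpha> i * ln 2 \<le> 1 * 1"
      using elim ln_2_less_1 by (intro mult_mono) auto
    moreover have "ln 2 \<le> (1::real)" using ln_2_less_1 by simp
    ultimately show "(1 - \<alpha> i) * ln (\<theta> i) \<le> ln (real (k i)) - \<alpha> i * ln (real (n i)) + 2"
      by (simp add: algebra_simps)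
  qed
qed

text \<open>In terms of \<theta> / k the previous bound reads \<open>(1 - \<alpha>) * ln (\<theta> /
  k) \<le> 2 - \<alpha> * ln (n / k)\<close>, and ln (n / k) is at least a fixed multiple of ln n.
  With \<alpha> confined on both sides, \<theta> / k is thus at most a negative power of n up to a
  constant; values of \<theta> below 1 are absorbed by 1 / k.\<close>

lemma \<theta>_log_over_k: "((\<lambda>i. \<theta> i * (1 + ln (real (n i)))\<^sup>2 / real (k i)) \<longlongrightarrow> 0) F"
proof -
  obtain a0 where a0: "0 < a0" "\<forall>\<^sub>F i in F. a0 \<le> \<alpha> i"
    using \<alpha>_bounded_below by blast
  obtain a1 where a1: "a1 < 1" "\<forall>\<^sub>F i in F. \<alpha> i \<le> a1"
    using \<alpha>_bounded_above by blast
  define c1 where "c1 = 2 / (1 - a1)"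
  define c2 where "c2 = a0 * ((1 - \<gamma>) / 2)"
  have c2: "0 < c2" using a0 \<gamma> by (simp add: c2_def)
  show ?thesis
  proof (rule Lim_null_comparison)
    have "((\<lambda>x. exp (c1 - c2 * x) * (1 + x)\<^sup>2) \<longlongrightarrow> 0) at_top"
      using c2 by real_asymp
    then have "((\<lambda>i. exp (c1 - c2 * ln (real (n i))) * (1 + ln (real (n i)))\<^sup>2) \<longlongrightarrow> 0) F"
      by (rule filterlim_compose[OF _ ln_n_top])
    from tendsto_add[OF log_over_k this]
    show "((\<lambda>i. (1 + ln (real (n i)))\<^sup>2 / real (k i) + exp (c1 - c2 * ln (real (n i))) * (1 + ln (real (n i)))\<^sup>2) \<longlongrightarrow> 0) F"
      by simp
    show "\<forall>\<^sub>F i in F. norm (\<theta> i * (1 + ln (real (n i)))\<^sup>2 / real (k i))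
       \<le> (1 + ln (real (n i)))\<^sup>2 / real (k i) + exp (c1 - c2 * ln (real (n i))) * (1 + ln (real (n i)))\<^sup>2"
      using param ev_\<theta>_ln ev_ln_k_le ev_k[of 1] a0(2) a1(2) ev_ln_n[of 0]
    proof eventually_elim
      case (elim i)
      define x where "x = ln (real (n i))"
      define K where "K = real (k i)"
      have K: "1 \<le> K" and x: "0 \<le> x" using elim by (auto simp: K_def x_def)
      have "\<bar>\<theta> i\<bar> / K \<le> 1 / K + exp (c1 - c2 * x)"
      proof (cases "1 \<le> \<theta> i")
        case False
        then have "\<bar>\<theta> i\<bar> / K \<le> 1 / K" using elim K by (intro divide_right_mono) auto
        then show ?thesis by (simp add: add_increasing2)
      next
        case True
        have "(1 - \<alpha> i) * ln (\<theta> i) \<le> ln K - \<alpha> i * x + 2"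
          using elim True by (simp add: x_def K_def)
        then have "(1 - \<alpha> i) * (ln (\<theta> i) - ln K) \<le> 2 - \<alpha> i * (x - ln K)"
          by (simp add: algebra_simps)
        moreover have "c2 * x \<le> \<alpha> i * (x - ln K)"
        proof -
          have "a0 * ((1 - \<gamma>) / 2 * x) \<le> \<alpha> i * (x - ln K)"
            using elim a0 \<gamma> x by (intro mult_mono) (auto simp: x_def K_def)
          then show ?thesis by (simp add: c2_def mult.assoc)
        qed
        ultimately have *: "(1 - \<alpha> i) * (ln (\<theta> i) - ln K) \<le> 2 - c2 * x" by linarith
        have "ln (\<theta> i) - ln K \<le> (2 - c2 * x) / (1 - \<alpha> i)"
          using * elim by (simp add: pos_le_divide_eq mult.commute)
        also have "\<dots> = 2 / (1 - \<alpha> i) - c2 * x / (1 - \<alpha> i)" by (simp add: diff_divide_distrib)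
        also have "\<dots> \<le> c1 - c2 * x / 1"
          unfolding c1_def using a1(1) elim c2 x by (intro diff_mono divide_left_mono) auto
        finally have "ln (\<theta> i) - ln K \<le> c1 - c2 * x" by simp
        then have "exp (ln (\<theta> i) - ln K) \<le> exp (c1 - c2 * x)" by simp
        then have "\<bar>\<theta> i\<bar> / K \<le> exp (c1 - c2 * x)" using True K by (simp add: exp_diff)
        then show ?thesis using K by (simp add: add_increasing)
      qed
      then have "\<bar>\<theta> i\<bar> / K * (1 + x)\<^sup>2 \<le> (1 / K + exp (c1 - c2 * x)) * (1 + x)\<^sup>2"
        by (intro mult_right_mono) auto
      then show ?case
        using K by (simp add: x_def K_def abs_mult algebra_simps)
    qed
  qed
qed

lemma \<theta>_over_k: "((\<lambda>i. \<theta> i / real (k i)) \<longlongrightarrow> 0) F"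
proof (rule Lim_null_comparison[OF _ tendsto_rabs_zero[OF \<theta>_log_over_k]])
  show "\<forall>\<^sub>F i in F. norm (\<theta> i / real (k i)) \<le> \<bar>\<theta> i * (1 + ln (real (n i)))\<^sup>2 / real (k i)\<bar>"
    using ev_ln_n[of 0]
  proof eventually_elim
    case (elim i)
    have "\<bar>\<theta> i\<bar> * 1 \<le> \<bar>\<theta> i\<bar> * (1 + ln (real (n i)))\<^sup>2"
      using elim by (intro mult_left_mono) (auto intro!: one_le_power)
    then show ?case
      by (auto simp: abs_mult intro!: divide_right_mono)
  qed
qed

section \<open>Consistency of \<alpha> with a logarithmic rate\<close>

text \<open>Write \<open>b * g b - a * g a = b * (g b - g a) + (b - a) * g a\<close> for a at most
  b: the first term is nonnegative and \<open>g a \<ge> q\<close>. This slope bound stands in for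
  differentiability of g and also gives uniqueness of \<alpha>s.\<close>

lemma score_increase:
  assumes "0 < a" "a < 1" "0 < b" "b < 1"
  shows "q * \<bar>a - b\<bar> \<le> \<bar>a * g a - b * g b\<bar>"
  using assms
proof (induction a b rule: linorder_wlog)
  case (le a b)
  have "(b - a) * q \<le> (b - a) * g a"
    using le g_ge[of a] by (intro mult_left_mono) auto
  moreover have "b * g a \<le> b * g b"
    using le g_mono[of a b] by (intro mult_left_mono) auto
  ultimately have "q * (b - a) \<le> b * g b - a * g a" by (simp add: algebra_simps)
  then show ?case using le by auto
next
  case (sym a b)
  then show ?case by (simp add: abs_minus_commute)
qed

lemma \<alpha>_log: "((\<lambda>i. (\<alpha> i - \<alpha>s) * ln (real (n i))) \<longlongrightarrow> 0) F"
proof -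
  obtain a1 where a1: "a1 < 1" "\<forall>\<^sub>F i in F. \<alpha> i \<le> a1"
    using \<alpha>_bounded_above by blast
  define d where "d = 1 / (1 - a1)"
  have d: "0 < d" using a1 by (simp add: d_def)
  show ?thesis
  proof (rule Lim_null_comparison)
    let ?b = "\<lambda>i. (\<bar>d * c\<bar> * \<bar>ln (real (n i)) * D i\<bar> + (1 + ln (real (n i)))\<^sup>2 / real (k i)
       + (d + 1) * \<bar>\<theta> i * (1 + ln (real (n i)))\<^sup>2 / real (k i)\<bar>) / q"
    have "(?b \<longlongrightarrow> (\<bar>d * c\<bar> * \<bar>0\<bar> + 0 + (d + 1) * \<bar>0\<bar>) / q) F"
      using q by (intro tendsto_intros D log_over_k \<theta>_log_over_k) auto
    then show "(?b \<longlongrightarrow> 0) F" by simp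
    show "\<forall>\<^sub>F i in F. norm ((\<alpha> i - \<alpha>s) * ln (real (n i))) \<le> ?b i"
      using param ev_S H_g ev_k[of 1] a1(2) ev_ln_n[of 0]
    proof eventually_elim
      case (elim i)
      define x where "x = ln (real (n i))"
      define K where "K = real (k i)"
      have K: "1 \<le> K" and x: "0 \<le> x" using elim by (auto simp: K_def x_def)
      have d': "1 / (1 - \<alpha> i) \<le> d"
        unfolding d_def using elim a1(1) by (intro divide_left_mono) auto
      have "q * \<bar>\<alpha> i - \<alpha>s\<bar> \<le> \<bar>\<alpha> i * g (\<alpha> i) - 1\<bar>"
        using score_increase[of "\<alpha> i" \<alpha>s] \<alpha>s elim by auto
      \<comment> \<open>The error consists of the distance between g and H / k and, by the identity
        in \<open>ev_S\<close>, of 1 / k and \<open>\<theta> * S / k\<close>. Each remains o(1)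
        after multiplication by ln n.\<close>
      also have "\<alpha> i * g (\<alpha> i) - 1 = \<alpha> i * (g (\<alpha> i) - H i / K) + ((K - 1 - \<theta> i * S i) / K - 1)"
      proof -
        have "(K - 1 - \<theta> i * S i) = \<alpha> i * H i" using elim by (simp add: K_def)
        then show ?thesis using K by (simp add: algebra_simps)
      qed
      also have "(K - 1 - \<theta> i * S i) / K - 1 = - (1 / K) - \<theta> i * S i / K"
        using K by (simp add: field_simps)
      also have "\<bar>\<alpha> i * (g (\<alpha> i) - H i / K) + (- (1 / K) - \<theta> i * S i / K)\<bar>
          \<le> \<bar>g (\<alpha> i) - H i / K\<bar> + 1 / K + \<bar>\<theta> i\<bar> * S i / K"
      proof -
        have "\<bar>\<alpha> i * (g (\<alpha> i) - H i / K)\<bar> \<le> 1 * \<bar>g (\<alpha> i) - H i / K\<bar>"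
          unfolding abs_mult using elim by (intro mult_right_mono) auto
        moreover have "\<bar>\<theta> i * S i / K\<bar> = \<bar>\<theta> i\<bar> * S i / K"
          using elim K by (simp add: abs_mult)
        moreover have "\<bar>1 / K\<bar> = 1 / K" using K by simp
        moreover have "\<bar>u + (- v - w)\<bar> \<le> u' + v' + w'"
          if "\<bar>u\<bar> \<le> 1 * u'" "\<bar>w\<bar> = w'" "\<bar>v\<bar> = v'" for u v w u' v' w' :: real
          using that by linarith
        ultimately show ?thesis by blast
      qed
      also have "\<bar>g (\<alpha> i) - H i / K\<bar> \<le> \<bar>d * c\<bar> * \<bar>D i\<bar>"
      proof -
        have "\<bar>g (\<alpha> i) - H i / K\<bar> \<le> c * D i / (1 - \<alpha> i)"
          using elim by (simp add: K_def abs_minus_commute)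
        also have "\<dots> \<le> \<bar>c * D i\<bar> * (1 / (1 - \<alpha> i))"
          using elim by (simp add: divide_right_mono)
        also have "\<dots> \<le> \<bar>c * D i\<bar> * d"
          using d' by (intro mult_left_mono) auto
        finally show ?thesis using d by (simp add: abs_mult mult_ac)
      qed
      also have "\<bar>\<theta> i\<bar> * S i / K \<le> \<bar>\<theta> i\<bar> * ((d + 1) * (1 + x)) / K"
      proof -
        have "S i \<le> d + 1 + x" using elim d' by (auto simp: x_def)
        also have "\<dots> \<le> (d + 1) * (1 + x)" using d x by (simp add: algebra_simps)
        finally show ?thesis using K by (intro divide_right_mono mult_left_mono) auto
      qed
      finally have "q * \<bar>\<alpha> i - \<alpha>s\<bar> \<le> \<bar>d * c\<bar> * \<bar>D i\<bar> + 1 / K + \<bar>\<theta> i\<bar> * ((d + 1) * (1 + x)) / K" by simp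
      then have "q * \<bar>\<alpha> i - \<alpha>s\<bar> * x \<le> (\<bar>d * c\<bar> * \<bar>D i\<bar> + 1 / K + \<bar>\<theta> i\<bar> * ((d + 1) * (1 + x)) / K) * x"
        using x by (intro mult_right_mono)
      also have "\<dots> = \<bar>d * c\<bar> * \<bar>x * D i\<bar> + x / K + (d + 1) * (\<bar>\<theta> i\<bar> * ((1 + x) * x) / K)"
        using x by (simp add: abs_mult distrib_left distrib_right mult_ac add_divide_distrib)
      also have "x / K \<le> (1 + x)\<^sup>2 / K"
        using x K by (intro divide_right_mono) (auto simp: power2_eq_square algebra_simps)
      also have "\<bar>\<theta> i\<bar> * ((1 + x) * x) / K \<le> \<bar>\<theta> i\<bar> * (1 + x)\<^sup>2 / K"
        using x K by (intro divide_right_mono mult_left_mono) (auto simp: power2_eq_square algebra_simps)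
      also have "\<bar>\<theta> i\<bar> * (1 + x)\<^sup>2 / K = \<bar>\<theta> i * (1 + x)\<^sup>2 / K\<bar>"
        using K by (simp add: abs_mult)
      finally have "q * \<bar>\<alpha> i - \<alpha>s\<bar> * x \<le> \<bar>d * c\<bar> * \<bar>x * D i\<bar> + (1 + x)\<^sup>2 / K + (d + 1) * \<bar>\<theta> i * (1 + x)\<^sup>2 / K\<bar>"
        using d by (simp add: mult_left_mono)
      then show ?case
        using q x unfolding x_def[symmetric] K_def[symmetric] by (simp add: abs_mult pos_le_divide_eq mult_ac)
    qed
  qed
qed

lemma \<alpha>_tendsto: "(\<alpha> \<longlongrightarrow> \<alpha>s) F"
proof -
  have "((\<lambda>i. (\<alpha> i - \<alpha>s) * ln (real (n i)) / ln (real (n i))) \<longlongrightarrow> 0) F"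
    by (rule real_tendsto_divide_at_top[OF \<alpha>_log ln_n_top])
  then have "((\<lambda>i. \<alpha> i - \<alpha>s) \<longlongrightarrow> 0) F"
    by (rule Lim_transform_eventually) (use ev_ln_n[of 1] in \<open>eventually_elim, auto\<close>)
  then show ?thesis by (simp add: LIM_zero_iff)
qed

section \<open>Size of \<theta> in the different regimes\<close>

lemma \<theta>_bounded:
  assumes "\<forall>\<^sub>F i in F. ln (real (k i)) - \<alpha>s * ln (real (n i)) \<le> B"
  shows "\<exists>B'. \<forall>\<^sub>F i in F. \<bar>\<theta> i\<bar> \<le> B'"
proof -
  obtain a1 where a1: "a1 < 1" "\<forall>\<^sub>F i in F. \<alpha> i \<le> a1"
    using \<alpha>_bounded_above by blast
  \<comment> \<open>Of the 3, two units come from \<open>ev_\<theta>_ln\<close> and one from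
    exchanging \<alpha> for \<alpha>s; the absolute value keeps E nonnegative.\<close>
  define E where "E = \<bar>B + 3\<bar> / (1 - a1)"
  have E: "0 \<le> E" using a1 by (simp add: E_def)
  have "\<forall>\<^sub>F i in F. \<bar>(\<alpha> i - \<alpha>s) * ln (real (n i))\<bar> < 1"
    using tendsto_rabs_zero[OF \<alpha>_log] by (rule order_tendstoD) simp
  with assms param ev_\<theta>_ln a1(2) have "\<forall>\<^sub>F i in F. \<bar>\<theta> i\<bar> \<le> exp E"
  proof eventually_elim
    case (elim i)
    show ?case
    proof (cases "1 \<le> \<theta> i")
      case False
      then have "\<bar>\<theta> i\<bar> \<le> 1" using elim by auto
      also have "1 \<le> exp E" using E by simp
      finally show ?thesis .
    next
      case True
      then have "(1 - \<alpha> i) * ln (\<theta> i) \<le> ln (real (k i)) - \<alpha> i * ln (real (n i)) + 2"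
        using elim by simp
      also have "\<dots> = (ln (real (k i)) - \<alpha>s * ln (real (n i))) - (\<alpha> i - \<alpha>s) * ln (real (n i)) + 2"
        by (simp add: algebra_simps)
      also have "\<dots> \<le> \<bar>B + 3\<bar>" using elim by linarith
      finally have *: "(1 - \<alpha> i) * ln (\<theta> i) \<le> \<bar>B + 3\<bar>" .
      have "(1 - a1) * ln (\<theta> i) \<le> (1 - \<alpha> i) * ln (\<theta> i)"
        using elim True by (intro mult_right_mono) auto
      with * have "ln (\<theta> i) \<le> E"
        using a1 unfolding E_def by (simp add: pos_le_divide_eq mult.commute)
      then have "exp (ln (\<theta> i)) \<le> exp E" by simp
      then show ?thesis using True by simp
    qed
  qed
  then show ?thesis by blast
qed

text \<open>Apart from its first summand, the sum over the k blocks is at most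
  \<open>(1 + ln k) / \<alpha>\<close>, which falls short of ln n by an unbounded amount in this
  regime. The \<theta>-equation leaves only the first summand
  \<open>1 / (\<theta> + \<alpha>)\<close> to fill the gap.\<close>

lemma \<theta>_to_boundary:
  assumes "filterlim (\<lambda>i. ln (real (k i)) - \<alpha>s * ln (real (n i))) at_bot F"
  shows "(\<theta> \<longlongrightarrow> - \<alpha>s) F"
proof -
  have "((\<lambda>i. \<theta> i + \<alpha> i) \<longlongrightarrow> 0) F"
  proof (rule tendstoI)
    fix \<epsilon> :: real assume \<epsilon>: "0 < \<epsilon>"
    have "\<forall>\<^sub>F i in F. \<bar>(\<alpha> i - \<alpha>s) * ln (real (n i))\<bar> < 1"
      using tendsto_rabs_zero[OF \<alpha>_log] by (rule order_tendstoD) simp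
    \<comment> \<open>One unit is spent on replacing \<alpha>s by \<alpha>. The remaining 4 leaves
      room both for the 2 in \<open>ev_\<theta>_ln\<close>, which excludes
      \<open>\<theta> \<ge> 1\<close>, and for the \<open>1 + ln 2\<close> lost in the final
      comparison.\<close>
    moreover have "\<forall>\<^sub>F i in F. ln (real (k i)) - \<alpha>s * ln (real (n i)) \<le> - (5 + 1 / \<epsilon>)"
      using assms by (simp add: filterlim_at_bot)
    ultimately show "\<forall>\<^sub>F i in F. dist (\<theta> i + \<alpha> i) 0 < \<epsilon>"
      using param ev_\<theta>_ln eq_\<theta> ev_S ev_n[of 2] ev_k[of 1]
    proof eventually_elim
      case (elim i)
      define \<Lambda> where "\<Lambda> = ln (real (k i)) - \<alpha> i * ln (real (n i))"
      have "\<Lambda> = (ln (real (k i)) - \<alpha>s * ln (real (n i))) - (\<alpha> i - \<alpha>s) * ln (real (n i))"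
        by (simp add: \<Lambda>_def algebra_simps)
      then have \<Lambda>: "\<Lambda> < - (4 + 1 / \<epsilon>)" using elim by linarith
      have \<epsilon>': "0 < 1 / \<epsilon>" using \<epsilon> by simp
      have t: "\<theta> i < 1"
      proof (rule ccontr)
        assume *: "\<not> \<theta> i < 1"
        then have "(1 - \<alpha> i) * ln (\<theta> i) \<le> \<Lambda> + 2" using elim by (simp add: \<Lambda>_def)
        moreover have "0 \<le> (1 - \<alpha> i) * ln (\<theta> i)" using elim * by (intro mult_nonneg_nonneg) auto
        ultimately show False using \<Lambda> \<epsilon>' by linarith
      qed
      have a: "0 < \<alpha> i" "\<alpha> i < 1" "0 < \<theta> i + \<alpha> i" using elim by auto
      have "ln (real (n i) / 2) \<le> ln ((\<theta> i + real (n i)) / (\<theta> i + 1))"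
      proof (subst ln_le_cancel_iff)
        have "2 * (1 - \<theta> i) \<le> real (n i) * (1 - \<theta> i)"
          using t elim by (intro mult_right_mono) auto
        then have "real (n i) * (\<theta> i + 1) \<le> (\<theta> i + real (n i)) * 2"
          by (simp add: algebra_simps)
        then show "real (n i) / 2 \<le> (\<theta> i + real (n i)) / (\<theta> i + 1)"
          using a by (simp add: divide_le_eq pos_le_divide_eq)
      qed (use a elim in \<open>auto intro!: divide_pos_pos\<close>)
      also have "\<dots> \<le> (\<Sum>j=1..<k i. 1 / (\<theta> i + real j * \<alpha> i))" using elim by simp
      also have "\<dots> \<le> 1 / (\<theta> i + \<alpha> i) + (1 + ln (real (k i))) / \<alpha> i"
        using a elim by (intro sum_inverse_upper') auto
      finally have L: "ln (real (n i)) - ln 2 - (1 + ln (real (k i))) / \<alpha> i \<le> 1 / (\<theta> i + \<alpha> i)"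
        using elim by (simp add: ln_div)
      have *: "ln (real (n i)) - (1 + ln (real (k i))) / \<alpha> i = (- \<Lambda> - 1) / \<alpha> i"
        using a by (simp add: \<Lambda>_def field_simps)
      have "(- \<Lambda> - 1) / 1 \<le> ln (real (n i)) - (1 + ln (real (k i))) / \<alpha> i"
        unfolding *
      proof (rule divide_left_mono)
        show "0 \<le> - \<Lambda> - 1" using \<Lambda> \<epsilon>' by linarith
      qed (use a in auto)
      then have "- \<Lambda> - 1 \<le> ln (real (n i)) - (1 + ln (real (k i))) / \<alpha> i" by simp
      moreover have "d < y" if "- \<Lambda> - 1 \<le> x - z" "x - ln 2 - z \<le> y" "\<Lambda> < - (4 + d)" for d x y z :: real
        using that ln_2_less_1 by linarith
      ultimately have "1 / \<epsilon> < 1 / (\<theta> i + \<alpha> i)" using \<Lambda> L by blast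
      then have "\<theta> i + \<alpha> i < \<epsilon>" using a \<epsilon> by (simp add: field_simps)
      then show ?case using a by simp
    qed
  qed
  from tendsto_diff[OF this \<alpha>_tendsto] show ?thesis by simp
qed

text \<open>The sum over the k blocks decreases in \<theta>, while \<open>S\<close> is at most ln n
  plus a constant whatever \<theta> is. If \<theta> were below B, comparison with the value at B
  would bound \<open>ln k - \<alpha> * ln n\<close> from above.\<close>

lemma \<theta>_at_top:
  assumes "filterlim (\<lambda>i. ln (real (k i)) - \<alpha>s * ln (real (n i))) at_top F"
  shows "filterlim \<theta> at_top F"
proof (subst filterlim_at_top_gt[of _ _ 1], intro allI impI)
  fix B :: real assume B: "1 < B"
  obtain a0 where a0: "0 < a0" "\<forall>\<^sub>F i in F. a0 \<le> \<alpha> i"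
    using \<alpha>_bounded_below by blast
  obtain a1 where a1: "a1 < 1" "\<forall>\<^sub>F i in F. \<alpha> i \<le> a1"
    using \<alpha>_bounded_above by blast
  have "\<forall>\<^sub>F i in F. \<bar>(\<alpha> i - \<alpha>s) * ln (real (n i))\<bar> < 1"
    using tendsto_rabs_zero[OF \<alpha>_log] by (rule order_tendstoD) simp
  moreover have "\<forall>\<^sub>F i in F. 3 + 1 / (1 - a1) - ln (a0 / (B + 1)) \<le> ln (real (k i)) - \<alpha>s * ln (real (n i))"
    using assms by (simp add: filterlim_at_top)
  ultimately show "\<forall>\<^sub>F i in F. B \<le> \<theta> i"
    using param eq_\<theta> ev_S ev_n[of 2] ev_k[of 1] a0(2) a1(2)
  proof eventually_elim
    case (elim i)
    show ?case
    proof (rule ccontr)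
      assume t: "\<not> B \<le> \<theta> i"
      have a: "0 < \<alpha> i" "\<alpha> i < 1" "0 < \<theta> i + \<alpha> i" using elim by auto
      have "ln (real (k i) * (a0 / (B + 1))) \<le> ln ((B + real (k i) * \<alpha> i) / (B + \<alpha> i))"
      proof (subst ln_le_cancel_iff)
        have "real (k i) * a0 / (B + 1) \<le> (B + real (k i) * \<alpha> i) / (B + \<alpha> i)"
        proof (rule frac_le)
          have "real (k i) * a0 \<le> real (k i) * \<alpha> i"
            using elim by (intro mult_left_mono) auto
          then show "real (k i) * a0 \<le> B + real (k i) * \<alpha> i" using B by linarith
        qed (use a B a0 in \<open>auto intro!: add_nonneg_nonneg\<close>)
        then show "real (k i) * (a0 / (B + 1)) \<le> (B + real (k i) * \<alpha> i) / (B + \<alpha> i)" by simp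
      qed (use a B elim a0 in \<open>auto intro!: divide_pos_pos add_pos_nonneg mult_pos_pos\<close>)
      also have "\<dots> / \<alpha> i \<le> (\<Sum>j=1..<k i. 1 / (B + real j * \<alpha> i))"
        using a B elim by (intro sum_inverse_lower) auto
      also have "\<dots> \<le> (\<Sum>j=1..<k i. 1 / (\<theta> i + real j * \<alpha> i))"
      proof (intro sum_mono divide_left_mono)
        fix j assume "j \<in> {1..<k i}"
        then have "1 * \<alpha> i \<le> real j * \<alpha> i" using a by (intro mult_right_mono) auto
        then have "0 < \<theta> i + real j * \<alpha> i" "0 < B + real j * \<alpha> i" using a B by linarith+
        then show "0 < (B + real j * \<alpha> i) * (\<theta> i + real j * \<alpha> i)" by simp
      qed (use t in auto)
      also have "\<dots> \<le> 1 / (1 - \<alpha> i) + 1 + ln (real (n i))" using elim by simp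
      finally have "ln (real (k i) * (a0 / (B + 1))) \<le> \<alpha> i * (1 / (1 - \<alpha> i) + 1) + \<alpha> i * ln (real (n i))"
        using a by (simp add: divide_right_mono pos_divide_le_eq distrib_left mult.commute)
      moreover have "\<alpha> i * (1 / (1 - \<alpha> i) + 1) \<le> 1 / (1 - a1) + 1"
      proof -
        have "\<alpha> i * (1 / (1 - \<alpha> i) + 1) \<le> 1 * (1 / (1 - a1) + 1)"
          using a a1(1) elim by (intro mult_mono add_mono divide_left_mono) auto
        then show ?thesis by simp
      qed
      moreover have "ln (real (k i) * (a0 / (B + 1))) = ln (real (k i)) + ln (a0 / (B + 1))"
        using elim a0 B by (subst ln_mult) auto
      moreover have "\<alpha> i * ln (real (n i)) = (\<alpha> i - \<alpha>s) * ln (real (n i)) + \<alpha>s * ln (real (n i))"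
        by (simp add: algebra_simps)
      moreover have "3 + 1 / (1 - a1) - ln (a0 / (B + 1)) \<le> ln (real (k i)) - \<alpha>s * ln (real (n i))"
         "\<bar>(\<alpha> i - \<alpha>s) * ln (real (n i))\<bar> < 1"
        using elim by auto
      moreover have False if "u \<le> v + w" "v \<le> d + 1" "u = x + y" "w = e + z" "3 + d - y \<le> x - z" "\<bar>e\<bar> < 1"
        for u v w x y z d e :: real
        using that by linarith
      ultimately show False by blast
    qed
  qed
qed

lemma \<theta>_asymptotics:
  assumes "filterlim (\<lambda>i. ln (real (k i)) - \<alpha>s * ln (real (n i))) at_top F"
  shows "((\<lambda>i. ln (\<theta> i) - (ln \<alpha>s + (ln (real (k i)) - \<alpha>s * ln (real (n i)))) / (1 - \<alpha>s)) \<longlongrightarrow> 0) F"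
proof -
  note \<theta>_top = \<theta>_at_top[OF assms]
  have ev_\<theta>: "\<forall>\<^sub>F i in F. B \<le> \<theta> i" for B
    using \<theta>_top by (simp add: filterlim_at_top)
  obtain a0 where a0: "0 < a0" "\<forall>\<^sub>F i in F. a0 \<le> \<alpha> i"
    using \<alpha>_bounded_below by blast
  \<comment> \<open>These are the logarithmic errors of replacing
    \<open>\<theta> + k * \<alpha>\<close> by \<open>k * \<alpha>\<close>,
    \<open>\<theta> + n\<close> by n, and \<open>\<theta> + \<alpha>\<close> and
    \<open>\<theta> + 1\<close> by \<theta>. They vanish because \<theta> / k and k / n tend to 0
    and \<theta> tends to infinity; the two-sided estimates of both sums then pin down ln
    \<theta>.\<close>
  let ?r1 = "\<lambda>i. ln (1 + \<theta> i / real (k i) / \<alpha> i)"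
  let ?r2 = "\<lambda>i. ln (1 + \<theta> i / real (k i) * (1 / (real (n i) / real (k i))))"
  let ?r3 = "\<lambda>i. ln (1 + \<alpha> i / \<theta> i)"
  let ?r4 = "\<lambda>i. ln (1 + 1 / \<theta> i)"
  let ?\<Lambda> = "\<lambda>i. ln (real (k i)) - \<alpha> i * ln (real (n i))"
  let ?U = "\<lambda>i. ln (real (k i)) - \<alpha>s * ln (real (n i))"
  have inv\<theta>: "((\<lambda>i. x i / \<theta> i) \<longlongrightarrow> 0) F" if "(x \<longlongrightarrow> l) F" for x and l :: real
    using that \<theta>_top by (rule real_tendsto_divide_at_top)
  have invnk: "((\<lambda>i. 1 / (real (n i) / real (k i))) \<longlongrightarrow> 0) F"
    by (rule real_tendsto_divide_at_top[OF tendsto_const n_over_k_top])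
  have r1: "(?r1 \<longlongrightarrow> ln (1 + 0 / \<alpha>s)) F"
    using \<alpha>s by (intro tendsto_intros \<theta>_over_k \<alpha>_tendsto) auto
  have r2: "(?r2 \<longlongrightarrow> ln (1 + 0 * 0)) F"
    by (intro tendsto_intros \<theta>_over_k invnk) auto
  have r3: "(?r3 \<longlongrightarrow> ln (1 + 0)) F"
    by (intro tendsto_intros inv\<theta>[OF \<alpha>_tendsto]) auto
  have r4: "(?r4 \<longlongrightarrow> ln (1 + 0)) F"
    by (intro tendsto_intros inv\<theta>[OF tendsto_const]) auto
  have main: "((\<lambda>i. (1 - \<alpha> i) * ln (\<theta> i) - (ln (\<alpha> i) + ?\<Lambda> i)) \<longlongrightarrow> 0) F"
  proof (rule Lim_null_comparison)
    have "((\<lambda>i. \<bar>?r1 i\<bar> + \<bar>?r2 i\<bar> + \<bar>?r3 i\<bar> + \<bar>?r4 i\<bar>)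
       \<longlongrightarrow> \<bar>ln (1 + 0 / \<alpha>s)\<bar> + \<bar>ln (1 + 0 * 0)\<bar> + \<bar>ln (1 + 0)\<bar> + \<bar>ln (1 + 0)\<bar>) F"
      by (intro tendsto_intros r1 r2 r3 r4)
    then show "((\<lambda>i. \<bar>?r1 i\<bar> + \<bar>?r2 i\<bar> + \<bar>?r3 i\<bar> + \<bar>?r4 i\<bar>) \<longlongrightarrow> 0) F" by simp
    show "\<forall>\<^sub>F i in F. norm ((1 - \<alpha> i) * ln (\<theta> i) - (ln (\<alpha> i) + ?\<Lambda> i)) \<le> \<bar>?r1 i\<bar> + \<bar>?r2 i\<bar> + \<bar>?r3 i\<bar> + \<bar>?r4 i\<bar>"
      using param eq_\<theta> ev_S ev_n[of 2] ev_k[of 1] ev_\<theta>[of 1]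
    proof eventually_elim
      case (elim i)
      have a: "0 < \<alpha> i" "\<alpha> i < 1" "1 \<le> \<theta> i" "1 \<le> real (k i)" "2 \<le> real (n i)" using elim by auto
      define T where "T = ln (\<theta> i)"
      have 1: "ln (\<theta> i + real (k i) * \<alpha> i) = ln (\<alpha> i) + ln (real (k i)) + ?r1 i"
      proof -
        have "\<theta> i + real (k i) * \<alpha> i = \<alpha> i * (real (k i) * (1 + \<theta> i / real (k i) / \<alpha> i))"
          using a by (simp add: field_simps)
        moreover have "0 < 1 + \<theta> i / real (k i) / \<alpha> i" using a by (intro add_pos_nonneg) auto
        moreover have "ln (\<alpha> i * (real (k i) * z)) = ln (\<alpha> i) + ln (real (k i)) + ln z" if "0 < z" for z
          using that a by (simp add: ln_mult_pos)
        ultimately show ?thesis by metis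
      qed
      have 2: "ln (\<theta> i + real (n i)) = ln (real (n i)) + ?r2 i"
      proof -
        have "\<theta> i + real (n i) = real (n i) * (1 + \<theta> i / real (k i) * (1 / (real (n i) / real (k i))))"
          using a by (simp add: field_simps)
        moreover have "0 < 1 + \<theta> i / real (k i) * (1 / (real (n i) / real (k i)))" using a by (intro add_pos_nonneg) auto
        moreover have "0 < real (n i)" using a by simp
        ultimately show ?thesis using ln_mult_pos by metis
      qed
      have 3: "ln (\<theta> i + \<alpha> i) = T + ?r3 i"
      proof -
        have "\<theta> i + \<alpha> i = \<theta> i * (1 + \<alpha> i / \<theta> i)" using a by (simp add: field_simps)
        moreover have "0 < 1 + \<alpha> i / \<theta> i" using a by (intro add_pos_nonneg) auto
        moreover have "0 < \<theta> i" using a by simp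
        ultimately show ?thesis unfolding T_def using ln_mult_pos by metis
      qed
      have 4: "ln (\<theta> i + 1) = T + ?r4 i"
      proof -
        have "\<theta> i + 1 = \<theta> i * (1 + 1 / \<theta> i)" using a by (simp add: field_simps)
        moreover have "0 < 1 + 1 / \<theta> i" using a by (intro add_pos_nonneg) auto
        moreover have "0 < \<theta> i" using a by simp
        ultimately show ?thesis unfolding T_def using ln_mult_pos by metis
      qed
      have pos: "0 < \<theta> i + real (k i) * \<alpha> i" using a by (intro add_pos_nonneg) auto
      have "ln ((\<theta> i + real (k i) * \<alpha> i) / (\<theta> i + \<alpha> i)) / \<alpha> i \<le> S i"
        using sum_inverse_lower[of "\<alpha> i" "\<theta> i" "k i"] a elim by auto
      also have "S i \<le> ln ((\<theta> i + real (n i)) / \<theta> i)"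
        using sum_inverse_upper[of 1 "\<theta> i" "n i"] a by auto
      finally have "ln ((\<theta> i + real (k i) * \<alpha> i) / (\<theta> i + \<alpha> i)) \<le> \<alpha> i * ln ((\<theta> i + real (n i)) / \<theta> i)"
        using a by (simp add: pos_divide_le_eq mult.commute)
      then have A: "(ln (\<alpha> i) + ln (real (k i)) + ?r1 i) - (T + ?r3 i) \<le> \<alpha> i * (ln (real (n i)) + ?r2 i - T)"
        using a pos by (simp only: ln_div add_pos_pos 1 2 3 T_def[symmetric]) (simp add: ln_div 1 2 3 T_def[symmetric])
      have "ln ((\<theta> i + real (n i)) / (\<theta> i + 1)) \<le> S i"
        using elim by simp
      also have "S i \<le> ln ((\<theta> i + real (k i) * \<alpha> i) / \<theta> i) / \<alpha> i"
        using sum_inverse_upper[of "\<alpha> i" "\<theta> i" "k i"] a elim by auto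
      finally have "\<alpha> i * ln ((\<theta> i + real (n i)) / (\<theta> i + 1)) \<le> ln ((\<theta> i + real (k i) * \<alpha> i) / \<theta> i)"
        using a by (simp add: pos_le_divide_eq mult.commute)
      then have B: "\<alpha> i * (ln (real (n i)) + ?r2 i - (T + ?r4 i)) \<le> (ln (\<alpha> i) + ln (real (k i)) + ?r1 i) - T"
        using a pos by (simp add: ln_div 1 2 4 T_def[symmetric])
      have r: "\<bar>\<alpha> i * ?r2 i\<bar> \<le> \<bar>?r2 i\<bar>" "\<bar>\<alpha> i * ?r4 i\<bar> \<le> \<bar>?r4 i\<bar>"
        unfolding abs_mult using a by (auto intro!: mult_left_le_one_le)
      have "(ln (\<alpha> i) + ?\<Lambda> i) - (1 - \<alpha> i) * T \<le> \<alpha> i * ?r2 i - ?r1 i + ?r3 i"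
        using A by (simp only: right_diff_distrib distrib_left left_diff_distrib mult_1_left, linarith?)
      moreover have "(1 - \<alpha> i) * T - (ln (\<alpha> i) + ?\<Lambda> i) \<le> ?r1 i - \<alpha> i * ?r2 i + \<alpha> i * ?r4 i"
        using B by (simp only: right_diff_distrib distrib_left left_diff_distrib mult_1_left, linarith?)
      ultimately show ?case using r unfolding T_def[symmetric] real_norm_def by linarith
    qed
  qed
  \<comment> \<open>Passing from \<alpha> to \<alpha>s is delicate since \<open>?U\<close> can be of
    order ln n. The last term is \<open>?U * (1 / (1 - \<alpha>) - 1 / (1 - \<alpha>s))\<close>,
    written so that the convergent \<open>?U / ln n\<close> multiplies
    \<open>(\<alpha> - \<alpha>s) * ln n\<close>, which tends to 0 by
    \<open>\<alpha>_log\<close>.\<close>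
  have "((\<lambda>i. ((1 - \<alpha> i) * ln (\<theta> i) - (ln (\<alpha> i) + ?\<Lambda> i)) / (1 - \<alpha> i)
     + (ln (\<alpha> i) / (1 - \<alpha> i) - ln \<alpha>s / (1 - \<alpha>s)) - (\<alpha> i - \<alpha>s) * ln (real (n i)) / (1 - \<alpha> i)
     + (ln (real (k i)) / ln (real (n i)) - \<alpha>s) * ((\<alpha> i - \<alpha>s) * ln (real (n i))) / ((1 - \<alpha> i) * (1 - \<alpha>s)))
      \<longlongrightarrow> 0 / (1 - \<alpha>s) + (ln \<alpha>s / (1 - \<alpha>s) - ln \<alpha>s / (1 - \<alpha>s)) - 0 / (1 - \<alpha>s)
        + (\<gamma> - \<alpha>s) * 0 / ((1 - \<alpha>s) * (1 - \<alpha>s))) F"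
    using \<alpha>s by (intro tendsto_intros main \<alpha>_tendsto \<alpha>_log lnk) auto
  then have "((\<lambda>i. ((1 - \<alpha> i) * ln (\<theta> i) - (ln (\<alpha> i) + ?\<Lambda> i)) / (1 - \<alpha> i)
     + (ln (\<alpha> i) / (1 - \<alpha> i) - ln \<alpha>s / (1 - \<alpha>s)) - (\<alpha> i - \<alpha>s) * ln (real (n i)) / (1 - \<alpha> i)
     + (ln (real (k i)) / ln (real (n i)) - \<alpha>s) * ((\<alpha> i - \<alpha>s) * ln (real (n i))) / ((1 - \<alpha> i) * (1 - \<alpha>s)))
      \<longlongrightarrow> 0) F" by simp
  then show ?thesis
  proof (rule Lim_transform_eventually)
    show "\<forall>\<^sub>F i in F. ((1 - \<alpha> i) * ln (\<theta> i) - (ln (\<alpha> i) + ?\<Lambda> i)) / (1 - \<alpha> i)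
     + (ln (\<alpha> i) / (1 - \<alpha> i) - ln \<alpha>s / (1 - \<alpha>s)) - (\<alpha> i - \<alpha>s) * ln (real (n i)) / (1 - \<alpha> i)
     + (ln (real (k i)) / ln (real (n i)) - \<alpha>s) * ((\<alpha> i - \<alpha>s) * ln (real (n i))) / ((1 - \<alpha> i) * (1 - \<alpha>s))
      = ln (\<theta> i) - (ln \<alpha>s + ?U i) / (1 - \<alpha>s)"
      using param ev_ln_n[of 1]
    proof eventually_elim
      case (elim i)
      define T x K a where "T = ln (\<theta> i)" "x = ln (real (n i))" "K = ln (real (k i))" "a = \<alpha> i"
      define A where "A = ln a"
      have nz: "1 - a \<noteq> 0" "1 - \<alpha>s \<noteq> 0" "x \<noteq> 0" using elim \<alpha>s by (auto simp: T_x_K_a_def)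
      have "(K / x - \<alpha>s) * ((a - \<alpha>s) * x) = (K - \<alpha>s * x) * (a - \<alpha>s)"
        using nz by (simp add: field_simps)
      moreover have "(K - \<alpha>s * x) * (a - \<alpha>s) / ((1 - a) * (1 - \<alpha>s)) = (K - \<alpha>s * x) / (1 - a) - (K - \<alpha>s * x) / (1 - \<alpha>s)"
        using nz by (simp add: divide_simps) (simp add: algebra_simps)
      moreover have "((1 - a) * T - (A + (K - a * x))) / (1 - a) = T - (A + (K - a * x)) / (1 - a)"
        using nz by (simp add: diff_divide_distrib)
      moreover have "T - (A + (K - a * x)) / (1 - a) + (A / (1 - a) - B) - (a - \<alpha>s) * x / (1 - a) + ((K - \<alpha>s * x) / (1 - a) - C)
         = T - (B + C)" for B C
      proof -
        have "(A + (K - a * x)) / (1 - a) = A / (1 - a) - (a - \<alpha>s) * x / (1 - a) + (K - \<alpha>s * x) / (1 - a)"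
          unfolding add_divide_distrib[symmetric] diff_divide_distrib[symmetric] by (simp add: algebra_simps)
        then show ?thesis by simp
      qed
      ultimately show ?case
        unfolding T_x_K_a_def[symmetric] A_def[symmetric] by (simp only: add_divide_distrib)
    qed
  qed
qed

end

subsection \<open>Block sizes and the critical equations\<close>

lemma sum_list_block_sizes: "sum_list (block_sizes X n \<omega>) = n"
proof -
  let ?xs = "sample X n \<omega>"
  have "sum_list (block_sizes X n \<omega>) = (\<Sum>x\<in>set ?xs. count_list ?xs x)"
    by (simp add: block_sizes_def Let_def sum_list_distinct_conv_sum_set)
  also have "\<dots> = length ?xs" by (intro sum_count_set) auto
  finally show ?thesis by (simp add: sample_def)
qed

lemma num_blocks_eq_card: "num_blocks X n \<omega> = card ((\<lambda>i. X i \<omega>) ` {..<n})"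
  by (simp add: num_blocks_def block_sizes_def Let_def length_remdups_card_conv sample_def lessThan_atLeast0)

text \<open>The samples are prefixes of one sequence. This pathwise monotonicity later controls the
  normalising sequence between powers of two.\<close>

lemma num_blocks_mono: "m \<le> n \<Longrightarrow> num_blocks X m \<omega> \<le> num_blocks X n \<omega>"
  unfolding num_blocks_eq_card by (intro card_mono image_mono) auto

text \<open>With psi the digamma function this is psi(m - a) - psi(1 - a) for m at least 1: minus
  the derivative in a of the logarithm of the rising factorial of 1 - a of length m - 1. Sizes 0 and
  1 give the empty sum.\<close>

definition digamma_diff :: "nat \<Rightarrow> real \<Rightarrow> real" where
  "digamma_diff m a = (\<Sum>j=1..<m. 1 / (real j - a))"

definition ep_loglik :: "real \<Rightarrow> real \<Rightarrow> nat list \<Rightarrow> real" where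
  "ep_loglik \<alpha> \<theta> ns = (\<Sum>j=1..<length ns. ln (\<theta> + real j * \<alpha>)) - (\<Sum>j=1..<sum_list ns. ln (\<theta> + real j))
     + (\<Sum>m\<leftarrow>ns. \<Sum>j=1..<m. ln (real j - \<alpha>))"

lemma pochhammer_shift: "pochhammer (x + 1) (m - 1) = (\<Prod>j=1..<m. x + real j)" for x :: real
proof (cases m)
  case (Suc k)
  have "(\<Prod>j=1..<m. x + real j) = (\<Prod>j=0..<k. x + real (Suc j))"
    unfolding Suc One_nat_def by (rule prod.shift_bounds_Suc_ivl)
  then show ?thesis using Suc by (simp add: pochhammer_prod add_ac)
qed simp

lemma ln_prod_list_pochhammer:
  assumes "\<alpha> < 1"
  shows "0 < (\<Prod>m\<leftarrow>ns. pochhammer (1 - \<alpha>) (m - 1)) \<and>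
    ln (\<Prod>m\<leftarrow>ns. pochhammer (1 - \<alpha>) (m - 1)) = (\<Sum>m\<leftarrow>ns. \<Sum>j=1..<m. ln (real j - \<alpha>))"
proof (induction ns)
  case (Cons m ns)
  have *: "pochhammer (1 - \<alpha>) (m - 1) = (\<Prod>j=1..<m. real j - \<alpha>)"
    using pochhammer_shift[of "- \<alpha>" m] by simp
  have pos: "0 < real j - \<alpha>" if "j \<in> {1..<m}" for j
    using that assms by auto
  have "0 < (\<Prod>j=1..<m. real j - \<alpha>)"
    using pos by (intro prod_pos) auto
  moreover have "ln (\<Prod>j=1..<m. real j - \<alpha>) = (\<Sum>j=1..<m. ln (real j - \<alpha>))"
    using pos by (intro ln_prod) (auto simp: less_imp_neq[symmetric])
  ultimately show ?case using Cons by (simp add: *[unfolded One_nat_def] ln_mult_pos)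
qed simp

lemma ep_param_pos:
  assumes "ep_param (\<alpha>, \<theta>)" "1 \<le> j"
  shows "0 < \<theta> + real j * \<alpha>" "0 < \<theta> + real j" "0 < real j - \<alpha>"
proof -
  have "1 * \<alpha> \<le> real j * \<alpha>" using assms by (intro mult_right_mono) (auto simp: ep_param_def)
  moreover have "- \<alpha> < \<theta>" using assms by (simp add: ep_param_def)
  ultimately show "0 < \<theta> + real j * \<alpha>" by linarith
  show "0 < \<theta> + real j" "0 < real j - \<alpha>" using assms by (auto simp: ep_param_def)
qed

lemma ln_ep_lik:
  assumes "ep_param (\<alpha>, \<theta>)"
  shows "0 < ep_lik \<alpha> \<theta> ns" "ln (ep_lik \<alpha> \<theta> ns) = ep_loglik \<alpha> \<theta> ns"
proof -
  note pos = ep_param_pos[OF assms]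
  have 1: "0 < (\<Prod>i = 1..<length ns. \<theta> + real i * \<alpha>)"
    using pos by (intro prod_pos) auto
  have 2: "ln (\<Prod>i = 1..<length ns. \<theta> + real i * \<alpha>) = (\<Sum>i = 1..<length ns. ln (\<theta> + real i * \<alpha>))"
    using pos(1) by (intro ln_prod) (auto simp: less_imp_neq[symmetric])
  have 3: "0 < (\<Prod>i = 1..<sum_list ns. \<theta> + real i)"
    using pos by (intro prod_pos) auto
  have 4: "ln (\<Prod>i = 1..<sum_list ns. \<theta> + real i) = (\<Sum>i = 1..<sum_list ns. ln (\<theta> + real i))"
    using pos(2) by (intro ln_prod) (auto simp: less_imp_neq[symmetric])
  have "\<alpha> < 1" using assms by (simp add: ep_param_def)
  note 5 = ln_prod_list_pochhammer[OF this, of ns]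
  show "0 < ep_lik \<alpha> \<theta> ns"
    unfolding ep_lik_def pochhammer_shift using 1 3 5 by (intro mult_pos_pos divide_pos_pos) auto
  show "ln (ep_lik \<alpha> \<theta> ns) = ep_loglik \<alpha> \<theta> ns"
    unfolding ep_lik_def pochhammer_shift ep_loglik_def using 1 3 5
    by (simp only: ln_mult_pos ln_divide_pos divide_pos_pos 2 4)
qed

lemma DERIV_sum_list:
  assumes "\<And>m. m \<in> set ns \<Longrightarrow> ((\<lambda>x. f m x) has_real_derivative f' m) (at x)"
  shows "((\<lambda>x. \<Sum>m\<leftarrow>ns. f m x) has_real_derivative (\<Sum>m\<leftarrow>ns. f' m)) (at x)"
  using assms by (induction ns) (auto intro!: DERIV_add)

text \<open>The parameter set is open, so a maximiser is a local maximum in each variable separately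
  and both partial derivatives vanish. The radii keep the perturbed parameter admissible; moving
  \<alpha> also endangers \<open>- \<alpha> < \<theta>\<close>, hence
  \<open>\<theta> + \<alpha>\<close> in the second radius.\<close>

lemma ep_mle_critical:
  assumes "ep_mle ns (\<alpha>, \<theta>)"
  shows "0 < \<alpha>" "\<alpha> < 1" "- \<alpha> < \<theta>"
    and "(\<Sum>j=1..<length ns. 1 / (\<theta> + real j * \<alpha>)) = (\<Sum>j=1..<sum_list ns. 1 / (\<theta> + real j))"
    and "(\<Sum>j=1..<length ns. real j / (\<theta> + real j * \<alpha>)) = (\<Sum>m\<leftarrow>ns. digamma_diff m \<alpha>)"
proof -
  have param: "ep_param (\<alpha>, \<theta>)" and
    mx: "\<And>a t. ep_param (a, t) \<Longrightarrow> ep_lik a t ns \<le> ep_lik \<alpha> \<theta> ns"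
    using assms by (auto simp: ep_mle_def is_arg_max_linorder)
  show p: "0 < \<alpha>" "\<alpha> < 1" "- \<alpha> < \<theta>" using param by (auto simp: ep_param_def)
  have mxl: "ep_loglik a t ns \<le> ep_loglik \<alpha> \<theta> ns" if "ep_param (a, t)" for a t
  proof -
    have "ln (ep_lik a t ns) \<le> ln (ep_lik \<alpha> \<theta> ns)"
      using mx[OF that] ln_ep_lik(1)[OF that] ln_ep_lik(1)[OF param] by (subst ln_le_cancel_iff) auto
    then show ?thesis using ln_ep_lik(2)[OF that] ln_ep_lik(2)[OF param] by simp
  qed
  note pos = ep_param_pos[OF param]
  have "(\<Sum>j=1..<length ns. 1 / (\<theta> + real j * \<alpha>)) - (\<Sum>j=1..<sum_list ns. 1 / (\<theta> + real j)) = 0"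
  proof (rule DERIV_local_max)
    have "((\<lambda>t. ep_loglik \<alpha> t ns) has_real_derivative
        (\<Sum>j=1..<length ns. 1 / (\<theta> + real j * \<alpha>)) - (\<Sum>j=1..<sum_list ns. 1 / (\<theta> + real j)) + 0) (at \<theta>)"
      unfolding ep_loglik_def
      by (intro DERIV_add DERIV_diff DERIV_sum DERIV_const) (auto intro!: derivative_eq_intros pos)
    then show "((\<lambda>t. ep_loglik \<alpha> t ns) has_real_derivative
        (\<Sum>j=1..<length ns. 1 / (\<theta> + real j * \<alpha>)) - (\<Sum>j=1..<sum_list ns. 1 / (\<theta> + real j))) (at \<theta>)"
      by simp
    show "0 < \<theta> + \<alpha>" using p by simp
    show "\<forall>y. \<bar>\<theta> - y\<bar> < \<theta> + \<alpha> \<longrightarrow> ep_loglik \<alpha> y ns \<le> ep_loglik \<alpha> \<theta> ns"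
      using p by (intro allI impI mxl) (auto simp: ep_param_def)
  qed
  then show "(\<Sum>j=1..<length ns. 1 / (\<theta> + real j * \<alpha>)) = (\<Sum>j=1..<sum_list ns. 1 / (\<theta> + real j))"
    by simp
  have "(\<Sum>j=1..<length ns. real j / (\<theta> + real j * \<alpha>)) - 0 + (\<Sum>m\<leftarrow>ns. \<Sum>j=1..<m. - 1 / (real j - \<alpha>)) = 0"
  proof (rule DERIV_local_max)
    show "((\<lambda>a. ep_loglik a \<theta> ns) has_real_derivative
        (\<Sum>j=1..<length ns. real j / (\<theta> + real j * \<alpha>)) - 0 + (\<Sum>m\<leftarrow>ns. \<Sum>j=1..<m. - 1 / (real j - \<alpha>))) (at \<alpha>)"
      unfolding ep_loglik_def
      by (intro DERIV_add DERIV_diff DERIV_sum DERIV_const DERIV_sum_list) (auto intro!: derivative_eq_intros pos)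
    show "0 < min (min \<alpha> (1 - \<alpha>)) (\<theta> + \<alpha>)" using p by simp
    show "\<forall>y. \<bar>\<alpha> - y\<bar> < min (min \<alpha> (1 - \<alpha>)) (\<theta> + \<alpha>) \<longrightarrow> ep_loglik y \<theta> ns \<le> ep_loglik \<alpha> \<theta> ns"
      using p by (intro allI impI mxl) (auto simp: ep_param_def)
  qed
  then show "(\<Sum>j=1..<length ns. real j / (\<theta> + real j * \<alpha>)) = (\<Sum>m\<leftarrow>ns. digamma_diff m \<alpha>)"
    by (simp add: digamma_diff_def sum_negf sum_list_subtractf[of "\<lambda>_. 0", simplified])
qed

section \<open>The data side of the \<alpha>-equation and its limit\<close>

lemma digamma_diff_nonneg: "a < 1 \<Longrightarrow> 0 \<le> digamma_diff m a"
  unfolding digamma_diff_def by (intro sum_nonneg) auto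

lemma digamma_diff_mono: "a \<le> b \<Longrightarrow> b < 1 \<Longrightarrow> digamma_diff m a \<le> digamma_diff m b"
  unfolding digamma_diff_def by (intro sum_mono divide_left_mono mult_pos_pos) auto

lemma digamma_diff_ge:
  assumes "a < 1" "2 \<le> m"
  shows "1 / (1 - a) \<le> digamma_diff m a"
proof -
  have "(\<Sum>j\<in>{1}. 1 / (real j - a)) \<le> digamma_diff m a"
    unfolding digamma_diff_def using assms by (intro sum_mono2) auto
  then show ?thesis by simp
qed

text \<open>Chosen so that \<open>2 + ln m \<le> ln m * log_bound_const\<close> for every m at least
  2.\<close>

definition log_bound_const :: real where "log_bound_const = 2 / ln 2 + 1"

text \<open>The harmonic comparison with x = -a and step 1 isolates the only summand that is
  singular at a = 1. The logarithmic growth in m matches the weights log r of Assumption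
  (B).\<close>

lemma digamma_diff_le:
  assumes "0 < a" "a < 1" "2 \<le> m"
  shows "digamma_diff m a \<le> ln (real m) * (log_bound_const / (1 - a))"
proof -
  have "digamma_diff m a = (\<Sum>j=1..<m. 1 / (- a + real j * 1))"
    unfolding digamma_diff_def by simp
  also have "\<dots> \<le> 1 / (- a + 1) + (1 + ln (real m)) / 1"
    using assms by (intro sum_inverse_upper') auto
  finally have 1: "digamma_diff m a \<le> 1 / (1 - a) + 1 + ln (real m)" by simp
  have l: "ln 2 \<le> ln (real m)" "0 < ln (2::real)" using assms by auto
  have i: "1 \<le> 1 / (1 - a)" using assms by simp
  have "1 / (1 - a) + 1 + ln (real m) \<le> 1 / (1 - a) * (2 + ln (real m))"
  proof -
    have "ln (real m) * 1 \<le> ln (real m) * (1 / (1 - a))" using l(1) i assms(3) by (intro mult_left_mono ln_ge_zero) auto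
    with i show ?thesis by (simp add: distrib_left)
  qed
  also have "\<dots> \<le> 1 / (1 - a) * (ln (real m) * log_bound_const)"
  proof (intro mult_left_mono)
    have "ln 2 * (2 / ln 2) \<le> ln (real m) * (2 / ln 2)" using l by (intro mult_right_mono) auto
    then show "2 + ln (real m) \<le> ln (real m) * log_bound_const"
      by (simp add: log_bound_const_def distrib_left)
  qed (use assms in auto)
  finally show ?thesis using 1 by (simp add: mult_ac)
qed

definition limit_score :: "nat pmf \<Rightarrow> real \<Rightarrow> real" where
  "limit_score p a = (\<Sum>\<^sub>\<infinity>r\<in>{2..}. pmf p r * digamma_diff r a)"

lemma alpha_equation_iff: "alpha_equation p a \<longleftrightarrow> 1 / a = limit_score p a"
proof -
  have "(\<Sum>\<^sub>\<infinity>r\<in>{2..}. pmf p r * (\<Sum>i = 1..r - 1. 1 / (real i - a))) = limit_score p a"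
    unfolding limit_score_def digamma_diff_def
  proof (intro infsum_cong)
    fix r :: nat assume "r \<in> {2..}"
    then have "{1..r - 1} = {1..<r}" by auto
    then show "pmf p r * (\<Sum>i = 1..r - 1. 1 / (real i - a)) = pmf p r * (\<Sum>j = 1..<r. 1 / (real j - a))" by simp
  qed
  then show ?thesis by (simp add: alpha_equation_def)
qed

text \<open>The weights may change sign, so that one estimate serves both the limit score and the
  deviation of the empirical frequencies from it.\<close>

lemma summable_digamma_diff:
  fixes w :: "nat \<Rightarrow> real"
  assumes "(\<lambda>r. \<bar>w r\<bar> * ln (real r)) summable_on {2..}" "0 < a" "a < 1"
  shows "(\<lambda>r. w r * digamma_diff r a) summable_on {2..}"
    and "\<bar>\<Sum>\<^sub>\<infinity>r\<in>{2..}. w r * digamma_diff r a\<bar> \<le> log_bound_const * (\<Sum>\<^sub>\<infinity>r\<in>{2..}. \<bar>w r\<bar> * ln (real r)) / (1 - a)"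
proof -
  let ?c = "log_bound_const / (1 - a)"
  have le: "norm (w r * digamma_diff r a) \<le> \<bar>w r\<bar> * ln (real r) * ?c" if "r \<in> {2..}" for r
    using that digamma_diff_le[OF assms(2,3), of r] digamma_diff_nonneg[OF assms(3), of r]
    by (simp only: real_norm_def abs_mult mult.assoc abs_of_nonneg mult_left_mono abs_ge_zero atLeast_iff)
  have s: "(\<lambda>r. \<bar>w r\<bar> * ln (real r) * ?c) summable_on {2..}"
    using assms(1) by (rule summable_on_cmult_left)
  have a: "(\<lambda>r. norm (w r * digamma_diff r a)) summable_on {2..}"
    using s le by (rule summable_on_comparison_test) auto
  then show "(\<lambda>r. w r * digamma_diff r a) summable_on {2..}"
    by (rule abs_summable_summable)
  have "\<bar>\<Sum>\<^sub>\<infinity>r\<in>{2..}. w r * digamma_diff r a\<bar> \<le> (\<Sum>\<^sub>\<infinity>r\<in>{2..}. norm (w r * digamma_diff r a))"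
    using norm_infsum_bound[OF a] by simp
  also have "\<dots> \<le> (\<Sum>\<^sub>\<infinity>r\<in>{2..}. \<bar>w r\<bar> * ln (real r) * ?c)"
    using a s le by (intro infsum_mono) auto
  also have "\<dots> = (\<Sum>\<^sub>\<infinity>r\<in>{2..}. \<bar>w r\<bar> * ln (real r)) * ?c"
    by (rule infsum_cmult_left')
  finally show "\<bar>\<Sum>\<^sub>\<infinity>r\<in>{2..}. w r * digamma_diff r a\<bar> \<le> log_bound_const * (\<Sum>\<^sub>\<infinity>r\<in>{2..}. \<bar>w r\<bar> * ln (real r)) / (1 - a)"
    by (simp add: mult_ac)
qed

text \<open>Blocks are grouped by size; the family has finite support, and sizes 0 and 1 drop out
  because h vanishes there.\<close>

lemma score_eq_infsum:
  fixes h :: "nat \<Rightarrow> real"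
  assumes "h 0 = 0" "h 1 = 0"
  shows "((\<lambda>r. real (count_list ns r) * h r) has_sum (\<Sum>m\<leftarrow>ns. h m)) {2..}"
proof -
  have "((\<lambda>r. real (count_list ns r) * h r) has_sum (\<Sum>r\<in>set ns \<inter> {2..}. real (count_list ns r) * h r)) (set ns \<inter> {2..})"
    by (intro has_sum_finite) auto
  also have "(\<Sum>r\<in>set ns \<inter> {2..}. real (count_list ns r) * h r) = (\<Sum>r\<in>set ns. real (count_list ns r) * h r)"
  proof (intro sum.mono_neutral_left ballI)
    fix i assume "i \<in> set ns - set ns \<inter> {2..}"
    then have "i = 0 \<or> i = 1" by auto
    then show "real (count_list ns i) * h i = 0" using assms by auto
  qed auto
  also have "\<dots> = (\<Sum>m\<leftarrow>ns. h m)"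
  proof (induction ns)
    case (Cons m ns)
    have "(\<Sum>r\<in>set (m # ns). real (count_list (m # ns) r) * h r)
       = (\<Sum>r\<in>set (m # ns). real (count_list ns r) * h r) + (\<Sum>r\<in>set (m # ns). if r = m then h r else 0)"
      by (simp only: sum.distrib[symmetric]) (intro sum.cong, auto simp: algebra_simps)
    also have "(\<Sum>r\<in>set (m # ns). real (count_list ns r) * h r) = (\<Sum>r\<in>set ns. real (count_list ns r) * h r)"
      by (intro sum.mono_neutral_right) auto
    finally show ?case using Cons by simp
  qed simp
  finally show ?thesis
    by (rule has_sum_cong_neutral[THEN iffD1, rotated -1]) auto
qed

lemma score_approx:
  assumes p: "(\<lambda>r. pmf p r * ln (real r)) summable_on {2..}" and a: "0 < a" "a < 1"
  shows "\<bar>(\<Sum>m\<leftarrow>ns. digamma_diff m a) / k - limit_score p a\<bar>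
    \<le> log_bound_const * (\<Sum>\<^sub>\<infinity>r\<in>{2..}. \<bar>real (count_list ns r) / k - pmf p r\<bar> * ln (real r)) / (1 - a)"
proof -
  have d: "digamma_diff 0 a = 0" "digamma_diff 1 a = 0" by (auto simp: digamma_diff_def)
  have c: "((\<lambda>r. real (count_list ns r) / k * digamma_diff r a) has_sum (\<Sum>m\<leftarrow>ns. digamma_diff m a) / k) {2..}"
    using has_sum_cmult_left[OF score_eq_infsum[of "\<lambda>r. digamma_diff r a" ns, OF d], of "1 / k"] by (simp add: mult_ac)
  have p': "(\<lambda>r. \<bar>pmf p r\<bar> * ln (real r)) summable_on {2..}" using p by simp
  have s: "(\<lambda>r. pmf p r * digamma_diff r a) summable_on {2..}"
    by (rule summable_digamma_diff(1)[OF p' a])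
  have "(\<Sum>m\<leftarrow>ns. digamma_diff m a) / k - limit_score p a
     = (\<Sum>\<^sub>\<infinity>r\<in>{2..}. real (count_list ns r) / k * digamma_diff r a - pmf p r * digamma_diff r a)"
    using has_sum_add[OF c has_sum_uminusI[OF has_sum_infsum[OF s]]] unfolding limit_score_def
    by (simp add: infsumI)
  also have "\<dots> = (\<Sum>\<^sub>\<infinity>r\<in>{2..}. (real (count_list ns r) / k - pmf p r) * digamma_diff r a)"
    by (intro infsum_cong) (simp add: algebra_simps)
  finally have *: "(\<Sum>m\<leftarrow>ns. digamma_diff m a) / k - limit_score p a
     = (\<Sum>\<^sub>\<infinity>r\<in>{2..}. (real (count_list ns r) / k - pmf p r) * digamma_diff r a)" .
  show ?thesis unfolding *
  \<comment> \<open>It remains to show that the weighted deviations are summable. This matters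
    because \<open>infsum\<close> is 0 on non-summable families, where the right-hand side would
    collapse. The deviations are dominated by a finitely supported family plus the summable one of
    p.\<close>
  proof (rule summable_digamma_diff(2)[OF _ a])
    define l where "l r = (if r = 0 then 0 else ln (real r))" for r :: nat
    have "((\<lambda>r. real (count_list ns r) * l r) has_sum (\<Sum>m\<leftarrow>ns. l m)) {2..}"
      by (intro score_eq_infsum) (auto simp: l_def)
    from has_sum_imp_summable[OF has_sum_cmult_left[OF this, of "1 / \<bar>k\<bar>"]]
    have "(\<lambda>r. real (count_list ns r) * l r * (1 / \<bar>k\<bar>)) summable_on {2..}" .
    from summable_on_add[OF this p']
    have "(\<lambda>r. real (count_list ns r) * l r * (1 / \<bar>k\<bar>) + \<bar>pmf p r\<bar> * ln (real r)) summable_on {2..}" .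
    then have "(\<lambda>r. (real (count_list ns r) / \<bar>k\<bar> + \<bar>pmf p r\<bar>) * ln (real r)) summable_on {2..}"
      by (rule summable_on_cong[THEN iffD1, rotated]) (auto simp: l_def algebra_simps)
    then show "(\<lambda>r. \<bar>real (count_list ns r) / k - pmf p r\<bar> * ln (real r)) summable_on {2..}"
    proof (rule summable_on_comparison_test)
      fix r :: nat assume r: "r \<in> {2..}"
      have "\<bar>real (count_list ns r) / k - pmf p r\<bar> \<le> \<bar>real (count_list ns r) / k\<bar> + \<bar>pmf p r\<bar>"
        by linarith
      then show "\<bar>real (count_list ns r) / k - pmf p r\<bar> * ln (real r) \<le> (real (count_list ns r) / \<bar>k\<bar> + \<bar>pmf p r\<bar>) * ln (real r)"
        using r by (intro mult_right_mono) auto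
    qed auto
  qed
qed

lemma score_ge:
  assumes "a < 1" "2 \<le> r"
  shows "real (count_list ns r) / (1 - a) \<le> (\<Sum>m\<leftarrow>ns. digamma_diff m a)"
proof (induction ns)
  case (Cons m ns)
  then show ?case
    using digamma_diff_ge[OF assms] digamma_diff_nonneg[OF assms(1), of m] by (auto simp: add_divide_distrib)
qed simp

lemma limit_score_mono:
  assumes "(\<lambda>r. pmf p r * ln (real r)) summable_on {2..}" "0 < a" "a \<le> b" "b < 1"
  shows "limit_score p a \<le> limit_score p b"
  unfolding limit_score_def using assms
  by (intro infsum_mono summable_digamma_diff(1) mult_left_mono digamma_diff_mono) auto

lemma limit_score_ge:
  assumes "(\<lambda>r. pmf p r * ln (real r)) summable_on {2..}" "0 < a" "a < 1" "2 \<le> r"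
  shows "pmf p r \<le> limit_score p a"
proof -
  have "pmf p r * 1 \<le> pmf p r * digamma_diff r a"
  proof (intro mult_left_mono)
    have "1 \<le> 1 / (1 - a)" using assms by simp
    also have "\<dots> \<le> digamma_diff r a" using assms by (intro digamma_diff_ge) auto
    finally show "1 \<le> digamma_diff r a" .
  qed auto
  also have "\<dots> = (\<Sum>r\<in>{r}. pmf p r * digamma_diff r a)" by simp
  also have "\<dots> \<le> limit_score p a"
    unfolding limit_score_def using assms digamma_diff_nonneg[OF assms(3)]
    by (intro finite_sum_le_infsum summable_digamma_diff(1)) auto
  finally show ?thesis by simp
qed

text \<open>Without mass on sizes at least two the right side of the equation is 0, but 1 / a is
  not. The size found here is the one whose frequency becomes \<open>Q\<close>.\<close>

lemma alpha_equation_pmf_pos: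
  assumes "0 < a" "alpha_equation p a"
  shows "\<exists>r\<ge>2. 0 < pmf p r"
proof (rule ccontr)
  assume *: "\<not> (\<exists>r\<ge>2. 0 < pmf p r)"
  have "limit_score p a = (\<Sum>\<^sub>\<infinity>r\<in>{2::nat..}. 0)"
    unfolding limit_score_def using * by (intro infsum_cong) (auto simp: not_less le_antisym)
  then show False using assms by (simp add: alpha_equation_iff)
qed

subsection \<open>Convergence in probability as a filter limit\<close>

text \<open>
  An event holds eventually if its exceptional sets inside \<open>G\<close> are covered by measurable sets of vanishing
  probability. Taking \<open>G\<close> to be an event \<open>c1 \<le> C \<le> c2\<close> makes the random limit \<open>C\<close> bounded away
  from 0 and infinity.
\<close>

definition prob_filter :: "'w measure \<Rightarrow> 'w set \<Rightarrow> (nat \<times> 'w) filter" where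
  "prob_filter M G = Abs_filter (\<lambda>P. \<exists>A. (\<forall>n. A n \<in> sets M) \<and>
     (\<forall>n. \<forall>\<omega>\<in>space M. \<omega> \<in> G \<longrightarrow> \<not> P (n, \<omega>) \<longrightarrow> \<omega> \<in> A n) \<and> (\<lambda>n. measure M (A n)) \<longlonglongrightarrow> 0)"

context prob_space
begin

lemma eventually_prob_filter:
  "eventually P (prob_filter M G) \<longleftrightarrow> (\<exists>A. (\<forall>n. A n \<in> events) \<and>
     (\<forall>n. \<forall>\<omega>\<in>space M. \<omega> \<in> G \<longrightarrow> \<not> P (n, \<omega>) \<longrightarrow> \<omega> \<in> A n) \<and> (\<lambda>n. prob (A n)) \<longlonglongrightarrow> 0)"
  unfolding prob_filter_def
proof (rule eventually_Abs_filter, rule is_filter.intro, goal_cases)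
  case 1
  show ?case by (intro exI[of _ "\<lambda>_. {}"]) auto
next
  case (2 P Q)
  then obtain A B where A: "\<forall>n. A n \<in> events" "\<forall>n. \<forall>\<omega>\<in>space M. \<omega> \<in> G \<longrightarrow> \<not> P (n, \<omega>) \<longrightarrow> \<omega> \<in> A n" "(\<lambda>n. prob (A n)) \<longlonglongrightarrow> 0"
    and B: "\<forall>n. B n \<in> events" "\<forall>n. \<forall>\<omega>\<in>space M. \<omega> \<in> G \<longrightarrow> \<not> Q (n, \<omega>) \<longrightarrow> \<omega> \<in> B n" "(\<lambda>n. prob (B n)) \<longlonglongrightarrow> 0"
    by blast
  have "(\<lambda>n. prob (A n \<union> B n)) \<longlonglongrightarrow> 0"
  proof (rule Lim_null_comparison)
    show "(\<lambda>n. prob (A n) + prob (B n)) \<longlonglongrightarrow> 0" using tendsto_add[OF A(3) B(3)] by simp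
    show "\<forall>\<^sub>F n in sequentially. norm (prob (A n \<union> B n)) \<le> prob (A n) + prob (B n)"
      using A B by (intro always_eventually allI) (auto intro!: measure_Un_le)
  qed
  with A B show ?case by (intro exI[of _ "\<lambda>n. A n \<union> B n"]) auto
next
  case (3 P Q)
  then show ?case by blast
qed

lemma eventually_prob_filter_fst:
  assumes "eventually P sequentially"
  shows "\<forall>\<^sub>F x in prob_filter M G. P (fst x)"
proof -
  obtain N where N: "\<And>n. N \<le> n \<Longrightarrow> P n" using assms by (auto simp: eventually_sequentially)
  have "(\<lambda>n. prob (if n < N then space M else {})) \<longlonglongrightarrow> 0"
    by (rule Lim_transform_eventually[OF tendsto_const])
      (use eventually_ge_at_top[of N] in \<open>eventually_elim, auto\<close>)
  then show ?thesis
    unfolding eventually_prob_filter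
    by (intro exI[of _ "\<lambda>n. if n < N then space M else {}"]) (auto simp: not_less intro: N)
qed

lemma filterlim_fst_prob_filter: "filterlim fst sequentially (prob_filter M G)"
  unfolding filterlim_iff using eventually_prob_filter_fst by blast

lemma eventually_prob_filter_restrict:
  "(\<And>\<omega>. \<omega> \<in> G \<Longrightarrow> P \<omega>) \<Longrightarrow> \<forall>\<^sub>F x in prob_filter M G. P (snd x)"
  unfolding eventually_prob_filter by (intro exI[of _ "\<lambda>_. {}"]) auto

text \<open>The event of being a maximiser is of unknown measurability, and \<open>measure\<close>
  is 0 on non-measurable sets. Taking the whole space as cover in that case gives the cover
  probability \<open>1 - prob E\<close> for every n.\<close>

lemma eventually_prob_filter_prob_1:
  assumes "(\<lambda>n. prob {\<omega> \<in> space M. P n \<omega>}) \<longlonglongrightarrow> 1"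
  shows "\<forall>\<^sub>F x in prob_filter M G. P (fst x) (snd x)"
proof -
  let ?E = "\<lambda>n. {\<omega> \<in> space M. P n \<omega>}"
  let ?A = "\<lambda>n. if ?E n \<in> events then space M - ?E n else space M"
  have "prob (?A n) = 1 - prob (?E n)" for n
    by (auto simp: prob_compl measure_notin_sets prob_space)
  then have "(\<lambda>n. prob (?A n)) \<longlonglongrightarrow> 0"
    using tendsto_diff[OF tendsto_const[of 1] assms] by simp
  then show ?thesis
    unfolding eventually_prob_filter by (intro exI[of _ ?A]) auto
qed

lemma tendsto_prob_filter:
  assumes "tendsto_in_prob M Y Z"
  shows "((\<lambda>x. Y (fst x) (snd x) - Z (snd x)) \<longlongrightarrow> 0) (prob_filter M G)"
proof (rule tendstoI)
  fix \<epsilon> :: real assume "0 < \<epsilon>"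
  \<comment> \<open>The set where the deviation exceeds half of \<epsilon> covers all outcomes with
    deviation at least \<epsilon>, equality included.\<close>
  then have \<epsilon>: "0 < \<epsilon> / 2" "\<epsilon> / 2 < \<epsilon>" by auto
  have [measurable]: "\<And>n. Y n \<in> borel_measurable M" "Z \<in> borel_measurable M"
    using assms by (auto simp: tendsto_in_prob_def)
  let ?A = "\<lambda>n. {\<omega> \<in> space M. \<bar>Y n \<omega> - Z \<omega>\<bar> > \<epsilon> / 2}"
  have "(\<lambda>n. prob (?A n)) \<longlonglongrightarrow> 0"
    using assms \<epsilon>(1) unfolding tendsto_in_prob_def by blast
  moreover have "\<forall>n. ?A n \<in> events" by measurable
  ultimately show "\<forall>\<^sub>F x in prob_filter M G. dist (Y (fst x) (snd x) - Z (snd x)) 0 < \<epsilon>"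
    unfolding eventually_prob_filter using \<epsilon>(2) by (intro exI[of _ ?A]) (auto simp: dist_real_def)
qed

lemma positive_rv_tight:
  fixes C :: "'a \<Rightarrow> real"
  assumes [measurable]: "C \<in> borel_measurable M" and pos: "AE \<omega> in M. 0 < C \<omega>" and "0 < \<eta>"
  shows "\<exists>c1>0. \<exists>c2. prob {\<omega> \<in> space M. \<not> (c1 \<le> C \<omega> \<and> C \<omega> \<le> c2)} < \<eta>"
proof -
  let ?A = "\<lambda>i::nat. {\<omega> \<in> space M. \<not> (1 / real (Suc i) \<le> C \<omega> \<and> C \<omega> \<le> real (Suc i))}"
  have "(\<lambda>i. prob (?A i)) \<longlonglongrightarrow> prob (\<Inter>i. ?A i)"
  proof (rule finite_Lim_measure_decseq)
    show "range ?A \<subseteq> events" by auto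
    show "decseq ?A"
    proof (rule decseq_SucI)
      fix i
      have "1 / real (Suc (Suc i)) \<le> 1 / real (Suc i)" by (simp add: field_simps)
      then show "?A (Suc i) \<subseteq> ?A i" by fastforce
    qed
  qed
  moreover have "prob (\<Inter>i. ?A i) = 0"
  proof -
    have "\<omega> \<notin> (\<Inter>i. ?A i)" if "0 < C \<omega>" for \<omega>
    proof -
      obtain i where i: "max (C \<omega>) (1 / C \<omega>) < real i" using reals_Archimedean2 by blast
      then have "1 / real (Suc i) \<le> C \<omega>" "C \<omega> \<le> real (Suc i)"
        using that by (auto simp: field_simps)
      then show ?thesis by auto
    qed
    then have "AE \<omega> in M. \<omega> \<notin> (\<Inter>i. ?A i)" using pos by (rule eventually_mono[rotated])
    then show ?thesis by (subst prob_eq_0) auto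
  qed
  ultimately have "(\<lambda>i. prob (?A i)) \<longlonglongrightarrow> 0" by simp
  then have "\<forall>\<^sub>F i in sequentially. prob (?A i) < \<eta>"
    using \<open>0 < \<eta>\<close> by (rule order_tendstoD)
  then obtain i where "prob (?A i) < \<eta>" by (auto simp: eventually_sequentially)
  then show ?thesis by (intro exI[of _ "1 / real (Suc i)"] conjI exI[of _ "real (Suc i)"]) auto
qed

text \<open>This is the way back from the filter to probabilities. The bad set lies in the union of
  the cover and the event that C leaves the band; strictness in the bound for the latter leaves
  positive room for the cover.\<close>

lemma eventually_prob_lt:
  fixes C :: "'a \<Rightarrow> real"
  assumes [measurable]: "C \<in> borel_measurable M"
    and ev: "\<forall>\<^sub>F x in prob_filter M {\<omega>. c1 \<le> C \<omega> \<and> C \<omega> \<le> c2}. P (fst x) (snd x)"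
    and G: "prob {\<omega> \<in> space M. \<not> (c1 \<le> C \<omega> \<and> C \<omega> \<le> c2)} < \<eta>"
    and meas: "\<And>n. {\<omega> \<in> space M. \<not> P n \<omega>} \<in> events"
  shows "\<forall>\<^sub>F n in sequentially. prob {\<omega> \<in> space M. \<not> P n \<omega>} < \<eta>"
proof -
  obtain A where A: "\<And>n. A n \<in> events" "\<And>n \<omega>. \<omega> \<in> space M \<Longrightarrow> c1 \<le> C \<omega> \<Longrightarrow> C \<omega> \<le> c2 \<Longrightarrow> \<not> P n \<omega> \<Longrightarrow> \<omega> \<in> A n"
    "(\<lambda>n. prob (A n)) \<longlonglongrightarrow> 0"
    using ev unfolding eventually_prob_filter by auto
  let ?B = "{\<omega> \<in> space M. \<not> (c1 \<le> C \<omega> \<and> C \<omega> \<le> c2)}"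
  have "\<forall>\<^sub>F n in sequentially. prob (A n) < \<eta> - prob ?B"
    using A(3) by (rule order_tendstoD) (use G in simp)
  then show ?thesis
  proof eventually_elim
    case (elim n)
    have "prob {\<omega> \<in> space M. \<not> P n \<omega>} \<le> prob (A n \<union> ?B)"
      using A(2) by (intro finite_measure_mono sets.Un A(1)) (auto, measurable)
    also have "\<dots> \<le> prob (A n) + prob ?B"
      by (intro measure_Un_le A(1)) measurable
    finally show ?case using elim by simp
  qed
qed

text \<open>The band for C is chosen after \<eta>, so the limit is required on all bands with
  positive lower end; tightness of C in the open half-line makes the outcomes outside
  negligible.\<close>

lemma tendsto_in_probI:
  fixes C :: "'a \<Rightarrow> real"
  assumes C[measurable]: "C \<in> borel_measurable M" and pos: "AE \<omega> in M. 0 < C \<omega>"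
    and Y[measurable]: "\<And>n. Y n \<in> borel_measurable M" and Z[measurable]: "Z \<in> borel_measurable M"
    and lim: "\<And>c1 c2. 0 < c1 \<Longrightarrow>
      ((\<lambda>x. Y (fst x) (snd x) - Z (snd x)) \<longlongrightarrow> 0) (prob_filter M {\<omega>. c1 \<le> C \<omega> \<and> C \<omega> \<le> c2})"
  shows "tendsto_in_prob M Y Z"
  unfolding tendsto_in_prob_def
proof (intro conjI allI impI Y Z)
  fix \<epsilon> :: real assume \<epsilon>: "0 < \<epsilon>"
  show "(\<lambda>n. prob {\<omega> \<in> space M. \<bar>Y n \<omega> - Z \<omega>\<bar> > \<epsilon>}) \<longlonglongrightarrow> 0"
  proof (rule tendstoI)
    fix \<eta> :: real assume "0 < \<eta>"
    from positive_rv_tight[OF C pos this] obtain c1 c2 where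
      c: "0 < c1" "prob {\<omega> \<in> space M. \<not> (c1 \<le> C \<omega> \<and> C \<omega> \<le> c2)} < \<eta>" by blast
    have "\<forall>\<^sub>F x in prob_filter M {\<omega>. c1 \<le> C \<omega> \<and> C \<omega> \<le> c2}. \<not> \<bar>Y (fst x) (snd x) - Z (snd x)\<bar> > \<epsilon>"
      using tendstoD[OF lim[OF c(1)] \<epsilon>] by eventually_elim (simp add: dist_real_def)
    from eventually_prob_lt[OF C this c(2)]
    show "\<forall>\<^sub>F n in sequentially. dist (prob {\<omega> \<in> space M. \<bar>Y n \<omega> - Z \<omega>\<bar> > \<epsilon>}) 0 < \<eta>"
      by (simp add: dist_real_def)
  qed
qed

lemma rv_tight:
  fixes Y :: "'a \<Rightarrow> real"
  assumes [measurable]: "Y \<in> borel_measurable M" and "0 < \<eta>"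
  shows "\<exists>B. prob {\<omega> \<in> space M. B < \<bar>Y \<omega>\<bar>} \<le> \<eta>"
proof -
  have "AE \<omega> in M. 0 < 1 + \<bar>Y \<omega>\<bar>" by (intro AE_I2) auto
  from positive_rv_tight[OF _ this \<open>0 < \<eta>\<close>] obtain c1 c2
    where c: "0 < c1" "prob {\<omega> \<in> space M. \<not> (c1 \<le> 1 + \<bar>Y \<omega>\<bar> \<and> 1 + \<bar>Y \<omega>\<bar> \<le> c2)} < \<eta>" by auto
  have "prob {\<omega> \<in> space M. c2 < \<bar>Y \<omega>\<bar>} \<le> prob {\<omega> \<in> space M. \<not> (c1 \<le> 1 + \<bar>Y \<omega>\<bar> \<and> 1 + \<bar>Y \<omega>\<bar> \<le> c2)}"
    by (intro finite_measure_mono) auto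
  with c show ?thesis by (intro exI[of _ c2]) linarith
qed

lemma big_Op1I:
  fixes C :: "'a \<Rightarrow> real"
  assumes C[measurable]: "C \<in> borel_measurable M" and pos: "AE \<omega> in M. 0 < C \<omega>"
    and Y[measurable]: "\<And>n. Y n \<in> borel_measurable M"
    and bnd: "\<And>c1 c2. 0 < c1 \<Longrightarrow>
      \<exists>B. \<forall>\<^sub>F x in prob_filter M {\<omega>. c1 \<le> C \<omega> \<and> C \<omega> \<le> c2}. \<bar>Y (fst x) (snd x)\<bar> \<le> B"
  shows "big_Op1 M Y"
  unfolding big_Op1_def
proof (intro conjI allI impI Y)
  fix \<eta> :: real assume \<eta>: "0 < \<eta>"
  from positive_rv_tight[OF C pos this] obtain c1 c2 where
    c: "0 < c1" "prob {\<omega> \<in> space M. \<not> (c1 \<le> C \<omega> \<and> C \<omega> \<le> c2)} < \<eta>" by blast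
  obtain B where B: "\<forall>\<^sub>F x in prob_filter M {\<omega>. c1 \<le> C \<omega> \<and> C \<omega> \<le> c2}. \<bar>Y (fst x) (snd x)\<bar> \<le> B"
    using bnd[OF c(1)] by blast
  from eventually_prob_lt[OF C B c(2)] obtain N
    where N: "\<And>n. N \<le> n \<Longrightarrow> prob {\<omega> \<in> space M. \<not> \<bar>Y n \<omega>\<bar> \<le> B} < \<eta>"
    by (auto simp: eventually_sequentially)
  \<comment> \<open>The bound must hold for all n. The finitely many indices below N are treated by
    tightness of each single \<open>Y n\<close>, and \<open>B'\<close> is the largest
    threshold.\<close>
  obtain b where b: "\<And>n. prob {\<omega> \<in> space M. b n < \<bar>Y n \<omega>\<bar>} \<le> \<eta>"
    using rv_tight[OF Y \<eta>] by metis
  define B' where "B' = Max (insert B (b ` {..<N}))"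
  have "prob {\<omega> \<in> space M. B' < \<bar>Y n \<omega>\<bar>} \<le> \<eta>" for n
  proof (cases "N \<le> n")
    case True
    have "B \<le> B'" unfolding B'_def by (intro Max_ge) auto
    then have "prob {\<omega> \<in> space M. B' < \<bar>Y n \<omega>\<bar>} \<le> prob {\<omega> \<in> space M. \<not> \<bar>Y n \<omega>\<bar> \<le> B}"
      by (intro finite_measure_mono) auto
    then show ?thesis using N[OF True] by linarith
  next
    case False
    then have "b n \<le> B'" unfolding B'_def by (intro Max_ge) auto
    then have "prob {\<omega> \<in> space M. B' < \<bar>Y n \<omega>\<bar>} \<le> prob {\<omega> \<in> space M. b n < \<bar>Y n \<omega>\<bar>}"
      by (intro finite_measure_mono) auto
    then show ?thesis using b[of n] by linarith
  qed
  then show "\<exists>B. \<forall>n. prob {\<omega> \<in> space M. B < \<bar>Y n \<omega>\<bar>} \<le> \<eta>" by blast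
qed

end

subsection \<open>Growth of the number of blocks\<close>

lemma sublinear_of_small_increments:
  fixes v :: "nat \<Rightarrow> real"
  assumes "(\<lambda>j. v (Suc j) - v j) \<longlonglongrightarrow> 0" "0 < \<epsilon>"
  shows "\<exists>A. \<forall>j. \<bar>v j\<bar> \<le> A + \<epsilon> * real j"
proof -
  have "\<forall>\<^sub>F j in sequentially. \<bar>v (Suc j) - v j\<bar> < \<epsilon>"
    using tendsto_rabs_zero[OF assms(1)] assms(2) by (intro order_tendstoD) auto
  then obtain J where J: "\<And>j. J \<le> j \<Longrightarrow> \<bar>v (Suc j) - v j\<bar> < \<epsilon>"
    by (auto simp: eventually_sequentially)
  define A where "A = (\<Sum>i\<le>J. \<bar>v i\<bar>)"
  have A: "\<bar>v j\<bar> \<le> A" if "j \<le> J" for j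
    unfolding A_def using that by (intro member_le_sum) auto
  have "\<bar>v j\<bar> \<le> A + \<epsilon> * real j" for j
  proof (cases "j \<le> J")
    case True
    then show ?thesis using A[OF True] assms(2) by (simp add: add_increasing2)
  next
    case False
    then have "J \<le> j" by simp
    then show ?thesis
    proof (induction j rule: dec_induct)
      case base
      show ?case using A[of J] assms(2) by (simp add: add_increasing2)
    next
      case (step j)
      then show ?case using J[of j] by (simp add: algebra_simps)
    qed
  qed
  then show ?thesis by blast
qed

text \<open>Slow variation only controls quotients for a fixed factor, that is, increments along
  powers of two. They average to \<open>\<gamma> * ln 2\<close> per doubling, and monotonicity up to
  the constant c fills the gaps between consecutive powers.\<close>

lemma log_growth_of_dyadic:
  fixes f :: "nat \<Rightarrow> real"
  assumes mono: "\<And>m n. n0 \<le> n \<Longrightarrow> n \<le> m \<Longrightarrow> f n \<le> f m + c"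
    and dyadic: "(\<lambda>j. f (2 ^ Suc j) - f (2 ^ j)) \<longlonglongrightarrow> \<gamma> * ln 2"
  shows "(\<lambda>n. f n / ln (real n)) \<longlonglongrightarrow> \<gamma>"
proof -
  define g where "g = \<gamma> * ln 2"
  define v where "v j = f (2 ^ j) - real j * g" for j
  have l2: "0 < ln (2::real)" by simp
  have "(\<lambda>j. v (Suc j) - v j) \<longlonglongrightarrow> 0"
    using tendsto_diff[OF dyadic tendsto_const[of "\<gamma> * ln 2"]] by (simp add: v_def g_def algebra_simps)
  note sub = sublinear_of_small_increments[OF this]
  have ln_top: "filterlim (\<lambda>n. ln (real n)) at_top sequentially"
    by (rule filterlim_compose[OF ln_at_top filterlim_real_sequentially])
  have "(\<lambda>n. f n / ln (real n) - \<gamma>) \<longlonglongrightarrow> 0"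
  proof (rule tendstoI)
    fix \<epsilon> :: real assume \<epsilon>: "0 < \<epsilon>"
    \<comment> \<open>As l is at most \<open>ln n / ln 2\<close>, this makes
      \<open>\<delta> * l\<close> at most a quarter of \<open>\<epsilon> * ln n\<close>.\<close>
    define \<delta> where "\<delta> = \<epsilon> * ln 2 / 4"
    have \<delta>: "0 < \<delta>" using \<epsilon> by (simp add: \<delta>_def)
    obtain A where A: "\<And>j. \<bar>v j\<bar> \<le> A + \<delta> * real j" using sub[OF \<delta>] by blast
    define B where "B = \<bar>A\<bar> + \<delta> + \<bar>c\<bar> + \<bar>g\<bar>"
    have "\<forall>\<^sub>F n in sequentially. 4 * B / \<epsilon> < ln (real n)"
      using ln_top by (simp add: filterlim_at_top_dense)
    \<comment> \<open>From this size on, the largest power of two not exceeding n is at least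
      n0.\<close>
    moreover have "\<forall>\<^sub>F n in sequentially. 2 * n0 + 2 \<le> n" by (rule eventually_ge_at_top)
    ultimately show "\<forall>\<^sub>F n in sequentially. dist (f n / ln (real n) - \<gamma>) 0 < \<epsilon>"
    proof eventually_elim
      case (elim n)
      obtain l where l: "2 ^ l \<le> n" "n < 2 ^ (l + 1)"
        using ex_power_ivl1[of 2 n] elim by auto
      have "real (2 ^ l) \<le> real n" "real n \<le> real (2 ^ (l + 1))"
        using l by (simp_all only: of_nat_le_iff less_imp_le)
      then have "2 ^ l \<le> real n" "real n \<le> 2 ^ (l + 1)" by (simp_all only: of_nat_power of_nat_numeral)
      then have "ln (2 ^ l) \<le> ln (real n)" "ln (real n) \<le> ln (2 ^ (l + 1))"
        using elim by (auto simp del: power_Suc simp: ln_mono)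
      then have l1: "real l * ln 2 \<le> ln (real n)" and l2': "ln (real n) \<le> (real l + 1) * ln 2"
        by (simp_all only: ln_realpow of_nat_add of_nat_1)
      define x where "x = ln (real n)"
      have x: "0 < x" using elim by (simp add: x_def)
      have n0: "n0 \<le> 2 ^ l" using l(2) elim by simp
      have up: "f n \<le> f (2 ^ Suc l) + c" using mono[of n "2 ^ Suc l"] l elim by simp
      have lo: "f (2 ^ l) \<le> f n + c" using mono[OF n0 l(1)] .
      have e: "\<gamma> * x = g * (x / ln 2)" by (simp add: g_def)
      define y where "y = x / ln 2"
      have y: "real l \<le> y" "y \<le> real l + 1"
        using l1 l2' l2 by (auto simp: y_def x_def pos_le_divide_eq pos_divide_le_eq)
      have "\<bar>g * (y - real l)\<bar> \<le> \<bar>g\<bar>" "\<bar>g * (real l + 1 - y)\<bar> \<le> \<bar>g\<bar>"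
        unfolding abs_mult using y by (auto intro!: mult_left_le)
      then have g: "g * y - g * real l \<le> \<bar>g\<bar>" "g * real l + g - g * y \<le> \<bar>g\<bar>"
        by (auto simp: algebra_simps)
      have "f n - \<gamma> * x \<le> \<bar>v (Suc l)\<bar> + (g * real l + g - g * y) + c"
        using up e by (simp add: v_def y_def algebra_simps)
      moreover have "\<gamma> * x - f n \<le> \<bar>v l\<bar> + (g * y - g * real l) + c"
        using lo e by (simp add: v_def y_def algebra_simps)
      moreover have "\<bar>v l\<bar> \<le> \<bar>A\<bar> + \<delta> + \<delta> * real l" "\<bar>v (Suc l)\<bar> \<le> \<bar>A\<bar> + \<delta> + \<delta> * real l"
        using A[of l] A[of "Suc l"] \<delta> by (auto simp: algebra_simps)
      ultimately have "\<bar>f n - \<gamma> * x\<bar> \<le> B + \<delta> * real l"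
        using g unfolding B_def by linarith
      also have "\<delta> * real l \<le> \<delta> * y" using y \<delta> by (intro mult_left_mono) auto
      also have "\<delta> * y = \<epsilon> * x / 4" by (simp add: \<delta>_def y_def)
      also have "B < \<epsilon> * x / 4" using elim \<epsilon> by (simp add: x_def field_simps)
      finally have "\<bar>f n - \<gamma> * x\<bar> < \<epsilon> * x" using x \<epsilon> mult_pos_pos[OF \<epsilon> x] by linarith
      moreover have "f n / x - \<gamma> = (f n - \<gamma> * x) / x" using x by (simp add: field_simps)
      ultimately show ?case using x unfolding x_def[symmetric]
        by (simp add: dist_real_def pos_divide_less_eq)
    qed
  qed
  then show ?thesis by (simp add: LIM_zero_iff)
qed

text \<open>For the factor 1 the quotient is 1 where L is nonzero and \<open>0 / 0 = 0\<close>
  elsewhere, so the limit 1 eventually excludes zeros of L.\<close>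

lemma slowly_varying_eventually_pos:
  assumes "slowly_varying L"
  shows "eventually (\<lambda>x. 0 < L x) at_top"
proof -
  have "((\<lambda>x. L (1 * x) / L x) \<longlongrightarrow> 1) at_top"
    using assms unfolding slowly_varying_def by (metis zero_less_one)
  then have "eventually (\<lambda>x. 0 < L (1 * x) / L x) at_top" by (rule order_tendstoD) simp
  with eventually_gt_at_top[of 0] show ?thesis
  proof eventually_elim
    case (elim x)
    then have "L x \<noteq> 0" "0 \<le> L x" using assms by (auto simp: slowly_varying_def)
    then show ?case by simp
  qed
qed

lemma slowly_varying_real_pos:
  "slowly_varying L \<Longrightarrow> \<forall>\<^sub>F n in sequentially. 0 < L (real n)"
  by (rule eventually_compose_filterlim[OF slowly_varying_eventually_pos filterlim_real_sequentially])

text \<open>Slow variation does not include measurability of \<open>L\<close> here, so Potter's bounds are not available.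
  Their role is taken by the monotonicity of the number of blocks, which makes the normalising
  sequence monotone up to a constant factor.\<close>

lemma (in prob_space) normaliser_quasi_mono:
  assumes K: "\<And>m n \<omega>. m \<le> n \<Longrightarrow> K m \<omega> \<le> (K n \<omega> :: nat)"
    and pos: "AE \<omega> in M. 0 < C \<omega>" and b: "\<forall>\<^sub>F n in sequentially. 0 < b n"
    and lim: "tendsto_in_prob M (\<lambda>n \<omega>. real (K n \<omega>) / b n) C"
  shows "\<exists>n0 c. \<forall>n\<ge>n0. \<forall>m\<ge>n. 0 < b n \<and> b n \<le> c * b m \<and> 0 < c"
proof -
  have C[measurable]: "C \<in> borel_measurable M" and Km[measurable]: "\<And>n. (\<lambda>\<omega>. real (K n \<omega>) / b n) \<in> borel_measurable M"
    using lim by (auto simp: tendsto_in_prob_def)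
  obtain c1 c2 where c: "0 < c1" "prob {\<omega> \<in> space M. \<not> (c1 \<le> C \<omega> \<and> C \<omega> \<le> c2)} < 1/4"
    using positive_rv_tight[OF C pos, of "1/4"] by auto
  let ?B = "{\<omega> \<in> space M. \<not> (c1 \<le> C \<omega> \<and> C \<omega> \<le> c2)}"
  let ?A = "\<lambda>n. {\<omega> \<in> space M. \<bar>real (K n \<omega>) / b n - C \<omega>\<bar> > c1 / 2}"
  have "(\<lambda>n. prob (?A n)) \<longlonglongrightarrow> 0"
    using lim half_gt_zero[OF c(1)] unfolding tendsto_in_prob_def by blast
  then have "\<forall>\<^sub>F n in sequentially. prob (?A n) < 1/4" by (rule order_tendstoD) simp
  with b have "\<forall>\<^sub>F n in sequentially. prob (?A n) < 1/4 \<and> 0 < b n" by eventually_elim simp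
  then obtain n0 where n0: "\<And>n. n0 \<le> n \<Longrightarrow> prob (?A n) < 1/4 \<and> 0 < b n"
    by (auto simp: eventually_sequentially)
  define c' where "c' = (\<bar>c2\<bar> + c1 / 2) / (c1 / 2)"
  have "0 < b n \<and> b n \<le> c' * b m \<and> 0 < c'" if nm: "n0 \<le> n" "n \<le> m" for n m
  proof -
    have bp: "0 < b n" "0 < b m" using n0[of n] n0[of m] nm by auto
    \<comment> \<open>Three events of probability below 1/4 cannot cover the space. One outcome
      outside them suffices, since b is deterministic: there monotonicity of K compares b n with b
      m, and \<open>c'\<close> is the upper bound for \<open>K m / b m\<close> over the lower bound
      for \<open>K n / b n\<close>.\<close>
    have "prob (?A n \<union> ?A m \<union> ?B) \<le> prob (?A n \<union> ?A m) + prob ?B"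
      by (intro measure_Un_le) auto
    also have "prob (?A n \<union> ?A m) \<le> prob (?A n) + prob (?A m)"
      by (intro measure_Un_le) auto
    finally have "prob (?A n \<union> ?A m \<union> ?B) < prob (space M)"
      using n0[of n] n0[of m] nm c(2) prob_space by linarith
    then have "?A n \<union> ?A m \<union> ?B \<noteq> space M" by auto
    then obtain \<omega> where "\<omega> \<in> space M" "\<omega> \<notin> ?A n \<union> ?A m \<union> ?B" by blast
    then have w: "\<bar>real (K n \<omega>) / b n - C \<omega>\<bar> \<le> c1 / 2" "\<bar>real (K m \<omega>) / b m - C \<omega>\<bar> \<le> c1 / 2" "c1 \<le> C \<omega>" "C \<omega> \<le> c2"
      by auto
    have "c1 / 2 \<le> real (K n \<omega>) / b n" using w by linarith
    then have "c1 / 2 * b n \<le> real (K n \<omega>)" using bp by (simp add: pos_le_divide_eq)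
    also have "\<dots> \<le> real (K m \<omega>)" using K[OF nm(2)] by simp
    also have "real (K m \<omega>) / b m \<le> \<bar>c2\<bar> + c1 / 2" using w by linarith
    then have "real (K m \<omega>) \<le> (\<bar>c2\<bar> + c1 / 2) * b m" using bp by (simp add: pos_divide_le_eq)
    finally have "b n \<le> c' * b m"
      using c(1) by (simp add: c'_def field_simps)
    then show ?thesis using bp c(1) by (auto simp: c'_def intro!: divide_pos_pos add_nonneg_pos)
  qed
  then show ?thesis by blast
qed

text \<open>This makes ln L(n) negligible against ln n, so that only the exponent \<gamma> survives
  in the limit of \<open>ln k / ln n\<close>.\<close>

lemma (in prob_space) normaliser_growth:
  assumes K: "\<And>m n \<omega>. m \<le> n \<Longrightarrow> K m \<omega> \<le> (K n \<omega> :: nat)"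
    and pos: "AE \<omega> in M. 0 < C \<omega>" and L: "slowly_varying L"
    and lim: "tendsto_in_prob M (\<lambda>n \<omega>. real (K n \<omega>) / (real n powr \<gamma> * L (real n))) C"
  shows "(\<lambda>n. ln (real n powr \<gamma> * L (real n)) / ln (real n)) \<longlonglongrightarrow> \<gamma>"
proof -
  let ?b = "\<lambda>n. real n powr \<gamma> * L (real n)"
  have b: "\<forall>\<^sub>F n in sequentially. 0 < ?b n"
    using slowly_varying_real_pos[OF L] eventually_gt_at_top[of 0] by eventually_elim auto
  obtain n0 c where c: "\<And>n m. n0 \<le> n \<Longrightarrow> n \<le> m \<Longrightarrow> 0 < ?b n \<and> ?b n \<le> c * ?b m \<and> 0 < c"
    using normaliser_quasi_mono[of K, OF K pos b lim] by blast
  show ?thesis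
  proof (rule log_growth_of_dyadic)
    fix m n assume nm: "n0 \<le> n" "n \<le> m"
    have "ln (?b n) \<le> ln (c * ?b m)"
      using c[OF nm] c[of m m] nm by (subst ln_le_cancel_iff) (auto intro!: mult_pos_pos)
    also have "\<dots> = ln c + ln (?b m)"
      using c[OF nm] c[of m m] nm by (intro ln_mult_pos) auto
    finally show "ln (?b n) \<le> ln (?b m) + ln c" by simp
  next
    have two: "filterlim (\<lambda>j. (2::real) ^ j) at_top sequentially"
      by real_asymp
    have "((\<lambda>x. L (2 * x) / L x) \<longlongrightarrow> 1) at_top"
      using L unfolding slowly_varying_def by (metis zero_less_numeral)
    from filterlim_compose[OF this two] have "(\<lambda>j. L (2 * 2 ^ j) / L (2 ^ j)) \<longlonglongrightarrow> 1" .
    from tendsto_ln[OF this] have "(\<lambda>j. \<gamma> * ln 2 + ln (L (2 * 2 ^ j) / L (2 ^ j))) \<longlonglongrightarrow> \<gamma> * ln 2 + ln 1"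
      by (intro tendsto_add tendsto_const) auto
    then have "(\<lambda>j. \<gamma> * ln 2 + ln (L (2 * 2 ^ j) / L (2 ^ j))) \<longlonglongrightarrow> \<gamma> * ln 2" by simp
    then show "(\<lambda>j. ln (?b (2 ^ Suc j)) - ln (?b (2 ^ j))) \<longlonglongrightarrow> \<gamma> * ln 2"
    proof (rule Lim_transform_eventually)
      have "\<forall>\<^sub>F j in sequentially. 0 < L (2 ^ j)"
        by (rule eventually_compose_filterlim[OF slowly_varying_eventually_pos[OF L] two])
      moreover have "\<forall>\<^sub>F j in sequentially. 0 < L (2 ^ Suc j)"
        using calculation by (subst eventually_sequentially_Suc)
      ultimately show "\<forall>\<^sub>F j in sequentially. \<gamma> * ln 2 + ln (L (2 * 2 ^ j) / L (2 ^ j)) = ln (?b (2 ^ Suc j)) - ln (?b (2 ^ j))"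
      proof eventually_elim
        case (elim j)
        then show ?case
          by (simp add: ln_mult_pos ln_divide_pos ln_powr ln_realpow algebra_simps)
      qed
    qed
  qed
qed

subsection \<open>The maximum likelihood estimator\<close>

text \<open>A maximiser is demanded only with probability tending to 1, because some samples have
  none: for n at least 2, with a single block or with all blocks of size one, the supremum 1 is
  approached at the edge of the parameter set but not attained.\<close>

locale ep_model = prob_space M
  for M :: "'w measure" and X :: "nat \<Rightarrow> 'w \<Rightarrow> 'x" and C :: "'w \<Rightarrow> real" and \<gamma> :: real
    and L :: "real \<Rightarrow> real" and p :: "nat pmf" and \<alpha>s :: real and \<alpha>h \<theta>h :: "nat \<Rightarrow> 'w \<Rightarrow> real" +
  assumes A: "assumption_A M X C \<gamma> L" and B: "assumption_B M X p"
    and \<alpha>s: "0 < \<alpha>s" "\<alpha>s < 1" "alpha_equation p \<alpha>s"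
    and \<alpha>h[measurable]: "\<And>n. \<alpha>h n \<in> borel_measurable M"
    and \<theta>h[measurable]: "\<And>n. \<theta>h n \<in> borel_measurable M"
    and mle: "(\<lambda>n. prob {\<omega> \<in> space M. ep_mle (block_sizes X n \<omega>) (\<alpha>h n \<omega>, \<theta>h n \<omega>)}) \<longlonglongrightarrow> 1"
begin

lemma C_measurable[measurable]: "C \<in> borel_measurable M"
  and C_pos: "AE \<omega> in M. 0 < C \<omega>" and \<gamma>: "0 < \<gamma>" "\<gamma> < 1" and sv: "slowly_varying L"
  and K_lim: "tendsto_in_prob M (\<lambda>n \<omega>. real (num_blocks X n \<omega>) / (real n powr \<gamma> * L (real n))) C"
  using A by (auto simp: assumption_A_def)

lemma p_summable: "(\<lambda>r. pmf p r * ln (real r)) summable_on {2..}"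
  using B by (auto simp: assumption_B_def)

abbreviation "b n \<equiv> real n powr \<gamma> * L (real n)"

abbreviation "FC c1 c2 \<equiv> prob_filter M {\<omega>. c1 \<le> C \<omega> \<and> C \<omega> \<le> c2}"

lemma b_growth: "(\<lambda>n. ln (b n) / ln (real n)) \<longlonglongrightarrow> \<gamma>"
  by (rule normaliser_growth[of "num_blocks X", OF num_blocks_mono C_pos sv K_lim])

lemma ln_top: "filterlim (\<lambda>n. ln (real n)) at_top sequentially"
  by (rule filterlim_compose[OF ln_at_top filterlim_real_sequentially])

lemma b_pos: "\<forall>\<^sub>F n in sequentially. 0 < b n \<and> ln (b n) = \<gamma> * ln (real n) + ln (L (real n))"
  using slowly_varying_real_pos[OF sv] eventually_gt_at_top[of 0]
  by eventually_elim (simp add: ln_mult_pos ln_powr)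

text \<open>For large n this is \<open>ln (b n) - \<alpha>s * ln n\<close>. On a band for C it
  differs from the logarithm of k divided by n to the power \<alpha>s by a bounded term, so its
  behaviour selects the regime deterministically.\<close>

definition V :: "nat \<Rightarrow> real" where "V n = (\<gamma> - \<alpha>s) * ln (real n) + ln (L (real n))"

lemma V_critical: "\<alpha>s = \<gamma> \<Longrightarrow> V n = ln (L (real n))"
  unfolding V_def by simp

lemma V_eq: "\<forall>\<^sub>F n in sequentially. V n = (ln (b n) / ln (real n) - \<alpha>s) * ln (real n)"
proof -
  have "\<forall>\<^sub>F n in sequentially. 0 < ln (real n)"
    using ln_top by (simp add: filterlim_at_top_dense)
  with b_pos show ?thesis
    by eventually_elim (simp add: V_def left_diff_distrib)
qed

lemma V_at_top: "\<alpha>s < \<gamma> \<Longrightarrow> filterlim V at_top sequentially"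
  by (subst filterlim_cong[OF refl refl V_eq],
    rule filterlim_tendsto_pos_mult_at_top[OF tendsto_diff[OF b_growth tendsto_const] _ ln_top]) simp

lemma V_at_bot: "\<gamma> < \<alpha>s \<Longrightarrow> filterlim V at_bot sequentially"
  by (subst filterlim_cong[OF refl refl V_eq],
    rule filterlim_tendsto_neg_mult_at_bot[OF tendsto_diff[OF b_growth tendsto_const] _ ln_top]) simp

context
  fixes c1 c2 :: real and F
  assumes c1: "0 < c1"
  defines "F \<equiv> FC c1 c2"
begin

lemma ev_C: "\<forall>\<^sub>F x in F. c1 \<le> C (snd x) \<and> C (snd x) \<le> c2"
  unfolding F_def by (rule eventually_prob_filter_restrict) auto

lemma fst_F: "filterlim fst sequentially F"
  unfolding F_def by (rule filterlim_fst_prob_filter)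

lemma ev_fst: "eventually P sequentially \<Longrightarrow> \<forall>\<^sub>F x in F. P (fst x)"
  unfolding F_def by (rule eventually_prob_filter_fst)

text \<open>The lower bound c1 on C turns the additive limit into a multiplicative one, as needed
  for taking logarithms.\<close>

lemma num_blocks_ratio:
  "((\<lambda>x. real (num_blocks X (fst x) (snd x)) / b (fst x) / C (snd x)) \<longlongrightarrow> 1) F"
proof -
  have lim: "((\<lambda>x. real (num_blocks X (fst x) (snd x)) / b (fst x) - C (snd x)) \<longlongrightarrow> 0) F"
    unfolding F_def by (rule tendsto_prob_filter[OF K_lim])
  have "((\<lambda>x. real (num_blocks X (fst x) (snd x)) / b (fst x) / C (snd x) - 1) \<longlongrightarrow> 0) F"
  proof (rule Lim_null_comparison)
    show "((\<lambda>x. \<bar>real (num_blocks X (fst x) (snd x)) / b (fst x) - C (snd x)\<bar> / c1) \<longlongrightarrow> 0) F"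
      using tendsto_divide[OF tendsto_rabs_zero[OF lim] tendsto_const, of c1] c1 by simp
    show "\<forall>\<^sub>F x in F. norm (real (num_blocks X (fst x) (snd x)) / b (fst x) / C (snd x) - 1)
       \<le> \<bar>real (num_blocks X (fst x) (snd x)) / b (fst x) - C (snd x)\<bar> / c1"
      using ev_C
    proof eventually_elim
      case (elim x)
      define y where "y = real (num_blocks X (fst x) (snd x)) / b (fst x)"
      have "y / C (snd x) - 1 = (y - C (snd x)) / C (snd x)"
        using elim c1 by (simp add: field_simps)
      then have "norm (y / C (snd x) - 1) = \<bar>y - C (snd x)\<bar> / C (snd x)"
        using elim c1 by simp
      also have "\<dots> \<le> \<bar>y - C (snd x)\<bar> / c1"
        using elim c1 by (intro divide_left_mono) auto
      finally show ?case by (simp add: y_def)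
    qed
  qed
  then show ?thesis by (simp add: LIM_zero_iff)
qed

lemma ln_num_blocks:
  "((\<lambda>x. ln (real (num_blocks X (fst x) (snd x))) - ln (b (fst x)) - ln (C (snd x))) \<longlongrightarrow> 0) F"
proof -
  have "((\<lambda>x. ln (real (num_blocks X (fst x) (snd x)) / b (fst x) / C (snd x))) \<longlongrightarrow> ln 1) F"
    by (intro tendsto_ln num_blocks_ratio) simp
  then have "((\<lambda>x. ln (real (num_blocks X (fst x) (snd x)) / b (fst x) / C (snd x))) \<longlongrightarrow> 0) F" by simp
  moreover have "\<forall>\<^sub>F x in F. 0 < real (num_blocks X (fst x) (snd x)) / b (fst x) / C (snd x)"
    using num_blocks_ratio by (rule order_tendstoD) simp
  then have "\<forall>\<^sub>F x in F. ln (real (num_blocks X (fst x) (snd x)) / b (fst x) / C (snd x))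
     = ln (real (num_blocks X (fst x) (snd x))) - ln (b (fst x)) - ln (C (snd x))"
    using ev_C ev_fst[OF b_pos]
  proof eventually_elim
    case (elim x)
    define k where "k = real (num_blocks X (fst x) (snd x))"
    define y where "y = b (fst x)"
    have "0 < y" "0 < C (snd x)" "0 < k / y / C (snd x)"
      using elim c1 by (auto simp: k_def y_def)
    moreover have "0 \<le> k" by (simp add: k_def)
    moreover have "k \<noteq> 0" using \<open>0 < k / y / C (snd x)\<close> by auto
    ultimately have "0 < y" "0 < C (snd x)" "0 < k" by auto
    then show ?case unfolding k_def[symmetric] y_def[symmetric]
      by (simp only: ln_divide_pos divide_pos_pos)
  qed
  ultimately show ?thesis by (rule Lim_transform_eventually)
qed

lemma ev_ln_C: "\<forall>\<^sub>F x in F. \<bar>ln (C (snd x))\<bar> \<le> \<bar>ln c1\<bar> + \<bar>ln c2\<bar>"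
  using ev_C
proof eventually_elim
  case (elim x)
  have "ln c1 \<le> ln (C (snd x))" "ln (C (snd x)) \<le> ln c2"
    using elim c1 by (auto intro: ln_mono)
  then show ?case by linarith
qed

lemma ev_num_blocks_V:
  "\<forall>\<^sub>F x in F. \<bar>ln (real (num_blocks X (fst x) (snd x))) - \<alpha>s * ln (real (fst x)) - V (fst x)\<bar>
     \<le> \<bar>ln c1\<bar> + \<bar>ln c2\<bar> + 1"
proof -
  have "\<forall>\<^sub>F x in F. \<bar>ln (real (num_blocks X (fst x) (snd x))) - ln (b (fst x)) - ln (C (snd x))\<bar> < 1"
    using tendsto_rabs_zero[OF ln_num_blocks] by (rule order_tendstoD) simp
  with ev_ln_C ev_fst[OF b_pos] show ?thesis
  proof eventually_elim
    case (elim x)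
    then have "ln (b (fst x)) = V (fst x) + \<alpha>s * ln (real (fst x))"
      by (simp add: V_def algebra_simps)
    with elim show ?case by linarith
  qed
qed

lemma model_critical:
  assumes q: "2 \<le> q" "0 < pmf p q"
  shows "ep_critical F fst (\<lambda>x. num_blocks X (fst x) (snd x))
   (\<lambda>x. \<alpha>h (fst x) (snd x)) (\<lambda>x. \<theta>h (fst x) (snd x))
   (\<lambda>x. \<Sum>m\<leftarrow>block_sizes X (fst x) (snd x). digamma_diff m (\<alpha>h (fst x) (snd x)))
   (\<lambda>x. \<Sum>\<^sub>\<infinity>r\<in>{2..}. \<bar>real (num_blocks_of_size X r (fst x) (snd x)) / real (num_blocks X (fst x) (snd x)) - pmf p r\<bar> * ln (real r))
   (\<lambda>x. real (num_blocks_of_size X q (fst x) (snd x)) / real (num_blocks X (fst x) (snd x)))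
   (limit_score p) \<gamma> \<alpha>s (pmf p q) log_bound_const"
proof (rule ep_critical.intro)
  have crit: "\<forall>\<^sub>F x in F. ep_mle (block_sizes X (fst x) (snd x)) (\<alpha>h (fst x) (snd x), \<theta>h (fst x) (snd x))"
    unfolding F_def by (rule eventually_prob_filter_prob_1[OF mle])
  show "filterlim fst sequentially F" by (rule fst_F)
  show "0 < \<gamma>" "\<gamma> < 1" "0 < \<alpha>s" "\<alpha>s < 1" "0 < pmf p q" using \<gamma> \<alpha>s q by auto
  show "\<alpha>s * limit_score p \<alpha>s = 1"
    using \<alpha>s by (simp add: alpha_equation_iff field_simps)
  show "limit_score p a \<le> limit_score p b" if "0 < a" "a \<le> b" "b < 1" for a b
    using limit_score_mono[OF p_summable] that by blast
  show "pmf p q \<le> limit_score p a" if "0 < a" "a < 1" for a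
    using limit_score_ge[OF p_summable that q(1)] .
  have lnF: "filterlim (\<lambda>x. ln (real (fst x))) at_top F"
    by (rule filterlim_compose[OF ln_top fst_F])
  \<comment> \<open>After adding and subtracting \<open>ln (b n)\<close> and ln C, the first
    quotient carries the limit; the other two have eventually bounded numerators.\<close>
  have "((\<lambda>x. ln (b (fst x)) / ln (real (fst x))
      + (ln (real (num_blocks X (fst x) (snd x))) - ln (b (fst x)) - ln (C (snd x))) / ln (real (fst x))
      + ln (C (snd x)) / ln (real (fst x))) \<longlongrightarrow> \<gamma> + 0 + 0) F"
  proof (intro tendsto_add)
    show "((\<lambda>x. ln (b (fst x)) / ln (real (fst x))) \<longlongrightarrow> \<gamma>) F"
      by (rule filterlim_compose[OF b_growth fst_F])
    show "((\<lambda>x. (ln (real (num_blocks X (fst x) (snd x))) - ln (b (fst x)) - ln (C (snd x))) / ln (real (fst x))) \<longlongrightarrow> 0) F"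
      by (rule real_tendsto_divide_at_top[OF ln_num_blocks lnF])
    show "((\<lambda>x. ln (C (snd x)) / ln (real (fst x))) \<longlongrightarrow> 0) F"
    proof (rule Lim_null_comparison)
      show "((\<lambda>x. (\<bar>ln c1\<bar> + \<bar>ln c2\<bar>) / ln (real (fst x))) \<longlongrightarrow> 0) F"
        by (rule real_tendsto_divide_at_top[OF tendsto_const lnF])
      have "\<forall>\<^sub>F x in F. 0 < ln (real (fst x))" using lnF by (simp add: filterlim_at_top_dense)
      with ev_ln_C show "\<forall>\<^sub>F x in F. norm (ln (C (snd x)) / ln (real (fst x))) \<le> (\<bar>ln c1\<bar> + \<bar>ln c2\<bar>) / ln (real (fst x))"
        by eventually_elim (simp add: divide_right_mono)
    qed
  qed
  then show "((\<lambda>x. ln (real (num_blocks X (fst x) (snd x))) / ln (real (fst x))) \<longlongrightarrow> \<gamma>) F"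
    by (simp add: add_divide_distrib[symmetric])
  have "little_op1 M (\<lambda>n \<omega>. ln (real n) * (\<Sum>\<^sub>\<infinity>r\<in>{2..}. \<bar>real (num_blocks_of_size X r n \<omega>) / real (num_blocks X n \<omega>) - pmf p r\<bar> * ln (real r)))"
    using B by (simp add: assumption_B_def)
  from tendsto_prob_filter[OF this]
  show "((\<lambda>x. ln (real (fst x)) * (\<Sum>\<^sub>\<infinity>r\<in>{2..}. \<bar>real (num_blocks_of_size X r (fst x) (snd x)) / real (num_blocks X (fst x) (snd x)) - pmf p r\<bar> * ln (real r))) \<longlongrightarrow> 0) F"
    unfolding F_def by simp
  have "tendsto_in_prob M (\<lambda>n \<omega>. real (num_blocks_of_size X q n \<omega>) / real (num_blocks X n \<omega>)) (\<lambda>_. pmf p q)"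
    using B q by (simp add: assumption_B_def)
  from tendsto_prob_filter[OF this]
  show "((\<lambda>x. real (num_blocks_of_size X q (fst x) (snd x)) / real (num_blocks X (fst x) (snd x))) \<longlongrightarrow> pmf p q) F"
    unfolding F_def by (simp add: LIM_zero_iff)
  show "\<forall>\<^sub>F x in F. 0 < \<alpha>h (fst x) (snd x) \<and> \<alpha>h (fst x) (snd x) < 1 \<and> - \<alpha>h (fst x) (snd x) < \<theta>h (fst x) (snd x)"
    using crit by eventually_elim (auto dest: ep_mle_critical(1-3))
  show "\<forall>\<^sub>F x in F. (\<Sum>j=1..<num_blocks X (fst x) (snd x). 1 / (\<theta>h (fst x) (snd x) + real j * \<alpha>h (fst x) (snd x)))
      = (\<Sum>j=1..<fst x. 1 / (\<theta>h (fst x) (snd x) + real j))"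
    using crit by eventually_elim (auto dest: ep_mle_critical(4) simp: num_blocks_def sum_list_block_sizes)
  show "\<forall>\<^sub>F x in F. (\<Sum>j=1..<num_blocks X (fst x) (snd x). real j / (\<theta>h (fst x) (snd x) + real j * \<alpha>h (fst x) (snd x)))
      = (\<Sum>m\<leftarrow>block_sizes X (fst x) (snd x). digamma_diff m (\<alpha>h (fst x) (snd x)))"
    using crit by eventually_elim (auto dest: ep_mle_critical(5) simp: num_blocks_def)
  show "\<forall>\<^sub>F x in F. \<bar>(\<Sum>m\<leftarrow>block_sizes X (fst x) (snd x). digamma_diff m (\<alpha>h (fst x) (snd x))) / real (num_blocks X (fst x) (snd x))
        - limit_score p (\<alpha>h (fst x) (snd x))\<bar>
      \<le> log_bound_const * (\<Sum>\<^sub>\<infinity>r\<in>{2..}. \<bar>real (num_blocks_of_size X r (fst x) (snd x)) / real (num_blocks X (fst x) (snd x)) - pmf p r\<bar> * ln (real r)) / (1 - \<alpha>h (fst x) (snd x))"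
    using crit unfolding num_blocks_of_size_def
    by eventually_elim (intro score_approx p_summable ep_mle_critical(1,2))
  show "\<forall>\<^sub>F x in F. real (num_blocks_of_size X q (fst x) (snd x)) / real (num_blocks X (fst x) (snd x)) / (1 - \<alpha>h (fst x) (snd x))
       \<le> (\<Sum>m\<leftarrow>block_sizes X (fst x) (snd x). digamma_diff m (\<alpha>h (fst x) (snd x))) / real (num_blocks X (fst x) (snd x))"
    using crit
  proof eventually_elim
    case (elim x)
    from divide_right_mono[OF score_ge[OF ep_mle_critical(2)[OF elim] q(1), of "block_sizes X (fst x) (snd x)"], of "real (num_blocks X (fst x) (snd x))"]
    show ?case by (simp add: num_blocks_of_size_def mult.commute)
  qed
qed

end

section \<open>Transfer of the filter limits to convergence in probability\<close>

lemma ex_block_size: "\<exists>q\<ge>2. 0 < pmf p q"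
  using alpha_equation_pmf_pos \<alpha>s by blast

lemma \<alpha>_consistent: "tendsto_in_prob M \<alpha>h (\<lambda>_. \<alpha>s)"
proof (rule tendsto_in_probI[OF C_measurable C_pos \<alpha>h])
  fix c1 c2 :: real assume c1: "0 < c1"
  obtain q where q: "2 \<le> q" "0 < pmf p q" using ex_block_size by blast
  show "((\<lambda>x. \<alpha>h (fst x) (snd x) - \<alpha>s) \<longlongrightarrow> 0) (FC c1 c2)"
    using ep_critical.\<alpha>_tendsto[OF model_critical[OF c1 q]] by (simp add: LIM_zero_iff)
qed simp

text \<open>The first two regimes are treated together: what they share is that V diverges.\<close>

lemma \<theta>_regime_divergent:
  assumes V: "filterlim V at_top sequentially"
  shows "\<exists>e. little_op1 M e \<and>
          (\<forall>\<^sub>F n in sequentially. AE \<omega> in M.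
             \<theta>h n \<omega> = real n powr ((\<gamma> - \<alpha>s) / (1 - \<alpha>s))
               * (\<alpha>s * C \<omega> * L (real n)) powr (1 / (1 - \<alpha>s)) * (1 + e n \<omega>))"
proof -
  define main where "main n \<omega> = real n powr ((\<gamma> - \<alpha>s) / (1 - \<alpha>s)) * (\<alpha>s * C \<omega> * L (real n)) powr (1 / (1 - \<alpha>s))" for n \<omega>
  have [measurable]: "main n \<in> borel_measurable M" for n
    unfolding main_def by measurable
  obtain N where N: "\<And>n. N \<le> n \<Longrightarrow> 0 < L (real n) \<and> 0 < n"
    using eventually_conj[OF slowly_varying_real_pos[OF sv] eventually_gt_at_top[of 0]]
    by (auto simp: eventually_sequentially)
  have ln_main: "0 < main n \<omega> \<and> ln (main n \<omega>) = (ln \<alpha>s + ln (C \<omega>) + V n) / (1 - \<alpha>s)" if "N \<le> n" "0 < C \<omega>" for n \<omega>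
  proof -
    have pos: "0 < real n" "0 < \<alpha>s * C \<omega> * L (real n)" using N[OF that(1)] that(2) \<alpha>s by auto
    then have "real n \<noteq> 0" "\<alpha>s * C \<omega> * L (real n) \<noteq> 0" by linarith+
    then have "0 < main n \<omega>" unfolding main_def by (intro mult_pos_pos iffD2[OF powr_gt_zero])
    moreover have "ln (main n \<omega>) = (\<gamma> - \<alpha>s) / (1 - \<alpha>s) * ln (real n) + 1 / (1 - \<alpha>s) * (ln \<alpha>s + ln (C \<omega>) + ln (L (real n)))"
      unfolding main_def using pos N[OF that(1)] that(2) \<alpha>s
      by (simp add: ln_mult_pos ln_powr)
    ultimately show ?thesis by (simp add: V_def add_divide_distrib)
  qed
  \<comment> \<open>This is the exact relative error wherever \<open>main\<close> is positive, that
    is, for n at least N and C > 0; the latter restricts the identity to almost all outcomes. The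
    value 0 for small n is a default, as the identity is claimed only eventually.\<close>
  define e where "e n \<omega> = (if N \<le> n then \<theta>h n \<omega> / main n \<omega> - 1 else 0)" for n \<omega>
  have "little_op1 M e"
  proof (rule tendsto_in_probI[OF C_measurable C_pos])
    show "e n \<in> borel_measurable M" for n unfolding e_def by measurable
    fix c1 c2 :: real assume c1: "0 < c1"
    obtain q where q: "2 \<le> q" "0 < pmf p q" using ex_block_size by blast
    interpret ep_critical "FC c1 c2" fst "\<lambda>x. num_blocks X (fst x) (snd x)"
       "\<lambda>x. \<alpha>h (fst x) (snd x)" "\<lambda>x. \<theta>h (fst x) (snd x)"
       "\<lambda>x. \<Sum>m\<leftarrow>block_sizes X (fst x) (snd x). digamma_diff m (\<alpha>h (fst x) (snd x))"
       "\<lambda>x. \<Sum>\<^sub>\<infinity>r\<in>{2..}. \<bar>real (num_blocks_of_size X r (fst x) (snd x)) / real (num_blocks X (fst x) (snd x)) - pmf p r\<bar> * ln (real r)"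
       "\<lambda>x. real (num_blocks_of_size X q (fst x) (snd x)) / real (num_blocks X (fst x) (snd x))"
       "limit_score p" \<gamma> \<alpha>s "pmf p q" log_bound_const
      by (rule model_critical[OF c1 q])
    let ?F = "FC c1 c2"
    let ?U = "\<lambda>x. ln (real (num_blocks X (fst x) (snd x))) - \<alpha>s * ln (real (fst x))"
    let ?lt = "\<lambda>x. ln (\<theta>h (fst x) (snd x))"
    have U: "filterlim ?U at_top ?F"
    proof (rule filterlim_at_top_mono)
      have "filterlim (\<lambda>x. V (fst x)) at_top ?F"
        by (rule filterlim_compose[OF V fst_F[OF c1]])
      then show "filterlim (\<lambda>x. - (\<bar>ln c1\<bar> + \<bar>ln c2\<bar> + 1) + V (fst x)) at_top ?F"
        by (rule filterlim_tendsto_add_at_top[OF tendsto_const])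
      show "\<forall>\<^sub>F x in ?F. - (\<bar>ln c1\<bar> + \<bar>ln c2\<bar> + 1) + V (fst x) \<le> ?U x"
        using ev_num_blocks_V[OF c1, of c2] by eventually_elim linarith
    qed
    \<comment> \<open>Exchanging ln k for \<open>ln (b n) + ln C\<close> turns the centring of
      \<open>\<theta>_asymptotics\<close> into the logarithm of \<open>main\<close>.\<close>
    have "((\<lambda>x. (?lt x - (ln \<alpha>s + ?U x) / (1 - \<alpha>s))
       + (ln (real (num_blocks X (fst x) (snd x))) - ln (b (fst x)) - ln (C (snd x))) / (1 - \<alpha>s)) \<longlongrightarrow> 0 + 0 / (1 - \<alpha>s)) ?F"
      using \<alpha>s by (intro tendsto_intros \<theta>_asymptotics[OF U] ln_num_blocks[OF c1]) auto
    from tendsto_exp[OF this] have "((\<lambda>x. exp ((?lt x - (ln \<alpha>s + ?U x) / (1 - \<alpha>s))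
       + (ln (real (num_blocks X (fst x) (snd x))) - ln (b (fst x)) - ln (C (snd x))) / (1 - \<alpha>s)) - 1) \<longlongrightarrow> exp (0 + 0 / (1 - \<alpha>s)) - 1) ?F"
      by (intro tendsto_diff tendsto_const)
    then have "((\<lambda>x. exp ((?lt x - (ln \<alpha>s + ?U x) / (1 - \<alpha>s))
       + (ln (real (num_blocks X (fst x) (snd x))) - ln (b (fst x)) - ln (C (snd x))) / (1 - \<alpha>s)) - 1) \<longlongrightarrow> 0) ?F"
      by simp
    moreover have "\<forall>\<^sub>F x in ?F. exp ((?lt x - (ln \<alpha>s + ?U x) / (1 - \<alpha>s))
       + (ln (real (num_blocks X (fst x) (snd x))) - ln (b (fst x)) - ln (C (snd x))) / (1 - \<alpha>s)) - 1 = e (fst x) (snd x) - 0"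
    proof -
      have "\<forall>\<^sub>F x in ?F. 1 \<le> \<theta>h (fst x) (snd x)"
        using \<theta>_at_top[OF U] by (simp add: filterlim_at_top)
      then show ?thesis
        using ev_C[OF c1, of c2] ev_fst[OF c1 b_pos, of c2] ev_fst[OF c1 eventually_ge_at_top[of N], of c2]
      proof eventually_elim
        case (elim x)
        define n where "n = fst x"
        define \<omega> where "\<omega> = snd x"
        define K where "K = ln (real (num_blocks X n \<omega>))"
        define t where "t = \<theta>h n \<omega>"
        have Cp: "0 < C \<omega>" using elim c1 by (auto simp: \<omega>_def)
        have n: "N \<le> n" and t: "0 < t" using elim by (auto simp: n_def t_def \<omega>_def)
        note m = ln_main[OF n Cp]
        have lb: "ln (b n) = V n + \<alpha>s * ln (real n)"
          using elim by (simp add: V_def n_def algebra_simps)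
        have "(ln t - (ln \<alpha>s + (K - \<alpha>s * ln (real n))) / (1 - \<alpha>s)) + (K - ln (b n) - ln (C \<omega>)) / (1 - \<alpha>s)
           = ln t - ((ln \<alpha>s + (K - \<alpha>s * ln (real n))) - (K - ln (b n) - ln (C \<omega>))) / (1 - \<alpha>s)"
          by (simp only: diff_divide_distrib)
        also have "\<dots> = ln t - ln (main n \<omega>)"
          unfolding lb conjunct2[OF m] by (simp add: algebra_simps)
        finally have E: "(ln t - (ln \<alpha>s + (K - \<alpha>s * ln (real n))) / (1 - \<alpha>s)) + (K - ln (b n) - ln (C \<omega>)) / (1 - \<alpha>s)
           = ln t - ln (main n \<omega>)" .
        have "exp ((ln t - (ln \<alpha>s + (K - \<alpha>s * ln (real n))) / (1 - \<alpha>s)) + (K - ln (b n) - ln (C \<omega>)) / (1 - \<alpha>s)) = t / main n \<omega>"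
          unfolding E using conjunct1[OF m] t by (simp add: exp_diff)
        then show ?case
          unfolding n_def[symmetric] \<omega>_def[symmetric] K_def[symmetric] t_def[symmetric]
          using n by (simp add: e_def t_def)
      qed
    qed
    ultimately show "((\<lambda>x. e (fst x) (snd x) - 0) \<longlongrightarrow> 0) ?F"
      by (rule Lim_transform_eventually)
  qed simp
  moreover have "\<forall>\<^sub>F n in sequentially. AE \<omega> in M. \<theta>h n \<omega> = main n \<omega> * (1 + e n \<omega>)"
    using eventually_ge_at_top[of N]
  proof eventually_elim
    case (elim n)
    show ?case
      using C_pos
    proof eventually_elim
      case (elim \<omega>)
      from ln_main[OF \<open>N \<le> n\<close> elim] show ?case using \<open>N \<le> n\<close> by (simp add: e_def)
    qed
  qed
  ultimately show ?thesis unfolding main_def by blast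
qed

lemma \<theta>_regime_bounded:
  assumes "\<alpha>s = \<gamma>" "(\<lambda>n. L (real n)) \<in> O(\<lambda>_. 1)"
  shows "big_Op1 M \<theta>h"
proof (rule big_Op1I[OF C_measurable C_pos \<theta>h])
  fix c1 c2 :: real assume c1: "0 < c1"
  obtain q where q: "2 \<le> q" "0 < pmf p q" using ex_block_size by blast
  obtain B where B: "0 < B" "\<forall>\<^sub>F n in sequentially. \<bar>L (real n)\<bar> \<le> B"
    using assms(2) by (auto elim!: landau_o.bigE)
  have "\<forall>\<^sub>F n in sequentially. V n \<le> ln B"
    using B(2) slowly_varying_real_pos[OF sv]
    by eventually_elim (auto simp: V_critical[OF assms(1)] intro!: ln_mono)
  from ev_fst[OF c1 this, of c2] ev_num_blocks_V[OF c1, of c2]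
  have "\<forall>\<^sub>F x in FC c1 c2. ln (real (num_blocks X (fst x) (snd x))) - \<alpha>s * ln (real (fst x)) \<le> ln B + (\<bar>ln c1\<bar> + \<bar>ln c2\<bar> + 1)"
    by eventually_elim linarith
  from ep_critical.\<theta>_bounded[OF model_critical[OF c1 q] this]
  show "\<exists>B. \<forall>\<^sub>F x in FC c1 c2. \<bar>\<theta>h (fst x) (snd x)\<bar> \<le> B" .
qed

lemma \<theta>_regime_boundary:
  assumes "\<gamma> < \<alpha>s"
  shows "tendsto_in_prob M (\<lambda>n \<omega>. \<theta>h n \<omega> + \<alpha>s) (\<lambda>_. 0)"
proof (rule tendsto_in_probI[OF C_measurable C_pos])
  fix c1 c2 :: real assume c1: "0 < c1"
  obtain q where q: "2 \<le> q" "0 < pmf p q" using ex_block_size by blast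
  let ?U = "\<lambda>x. ln (real (num_blocks X (fst x) (snd x))) - \<alpha>s * ln (real (fst x))"
  have "filterlim ?U at_bot (FC c1 c2)"
    unfolding filterlim_at_bot
  proof
    fix Z
    have "\<forall>\<^sub>F n in sequentially. V n \<le> Z - (\<bar>ln c1\<bar> + \<bar>ln c2\<bar> + 1)"
      using V_at_bot[OF assms] by (simp add: filterlim_at_bot)
    from ev_fst[OF c1 this, of c2] ev_num_blocks_V[OF c1, of c2]
    show "\<forall>\<^sub>F x in FC c1 c2. ?U x \<le> Z" by eventually_elim linarith
  qed
  from ep_critical.\<theta>_to_boundary[OF model_critical[OF c1 q] this]
  have "((\<lambda>x. \<theta>h (fst x) (snd x) - - \<alpha>s) \<longlongrightarrow> 0) (FC c1 c2)"
    by (simp only: LIM_zero_iff)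
  then show "((\<lambda>x. \<theta>h (fst x) (snd x) + \<alpha>s - 0) \<longlongrightarrow> 0) (FC c1 c2)" by simp
qed measurable

text \<open>By \<open>score_increase\<close> the distance between a and \<alpha>s is controlled by
  two values that are both 1. The band starting at c1 = 1 serves to instantiate the locale.\<close>

lemma alpha_equation_unique:
  assumes "0 < a" "a < 1" "alpha_equation p a"
  shows "a = \<alpha>s"
proof -
  obtain q where q: "2 \<le> q" "0 < pmf p q" using ex_block_size by blast
  have *: "a * limit_score p a = 1" "\<alpha>s * limit_score p \<alpha>s = 1"
    using assms \<alpha>s by (auto simp: alpha_equation_iff field_simps)
  have "pmf p q * \<bar>a - \<alpha>s\<bar> \<le> \<bar>a * limit_score p a - \<alpha>s * limit_score p \<alpha>s\<bar>"
    using ep_critical.score_increase[OF model_critical[OF zero_less_one q], of a \<alpha>s] assms \<alpha>s by auto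
  then show ?thesis using * q by (simp add: mult_le_0_iff)
qed

end

theorem theorem1:
  fixes M :: "'w measure" and X :: "nat \<Rightarrow> 'w \<Rightarrow> 'x"
    and C :: "'w \<Rightarrow> real" and \<gamma> :: real and L :: "real \<Rightarrow> real" and p :: "nat pmf"
    and \<alpha>s :: real and \<alpha>h \<theta>h :: "nat \<Rightarrow> 'w \<Rightarrow> real"
  assumes "prob_space M"
    and "assumption_A M X C \<gamma> L"
    and "assumption_B M X p"
    and "0 < \<alpha>s" and "\<alpha>s < 1" and "alpha_equation p \<alpha>s"
    and "\<And>n. \<alpha>h n \<in> borel_measurable M" and "\<And>n. \<theta>h n \<in> borel_measurable M"
    and "(\<lambda>n. measure M {\<omega> \<in> space M. ep_mle (block_sizes X n \<omega>) (\<alpha>h n \<omega>, \<theta>h n \<omega>)}) \<longlonglongrightarrow> 1"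
  shows "(\<forall>a. 0 < a \<and> a < 1 \<and> alpha_equation p a \<longrightarrow> a = \<alpha>s)
    \<and> tendsto_in_prob M \<alpha>h (\<lambda>_. \<alpha>s)
    \<and> (\<alpha>s < \<gamma> \<longrightarrow>
        (\<exists>e. little_op1 M e \<and>
          (\<forall>\<^sub>F n in sequentially. AE \<omega> in M.
             \<theta>h n \<omega> = real n powr ((\<gamma> - \<alpha>s) / (1 - \<alpha>s))
               * (\<alpha>s * C \<omega> * L (real n)) powr (1 / (1 - \<alpha>s)) * (1 + e n \<omega>))))
    \<and> (\<alpha>s = \<gamma> \<and> filterlim (\<lambda>n. L (real n)) at_top sequentially \<longrightarrow>
        (\<exists>e. little_op1 M e \<and>
          (\<forall>\<^sub>F n in sequentially. AE \<omega> in M.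
             \<theta>h n \<omega> = (\<gamma> * C \<omega> * L (real n)) powr (1 / (1 - \<gamma>)) * (1 + e n \<omega>))))
    \<and> (\<alpha>s = \<gamma> \<and> (\<lambda>n. L (real n)) \<in> O(\<lambda>_. 1) \<longrightarrow> big_Op1 M \<theta>h)
    \<and> (\<alpha>s > \<gamma> \<longrightarrow> (\<exists>e. little_op1 M e \<and> (\<forall>n. AE \<omega> in M. \<theta>h n \<omega> = - \<alpha>s + e n \<omega>)))"
proof -
  interpret ep_model M X C \<gamma> L p \<alpha>s \<alpha>h \<theta>h
    using assms by (simp add: ep_model_def ep_model_axioms_def)
  show ?thesis
  proof (intro conjI impI allI)
    show "a = \<alpha>s" if "0 < a \<and> a < 1 \<and> alpha_equation p a" for a
      using alpha_equation_unique that by blast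
    show "tendsto_in_prob M \<alpha>h (\<lambda>_. \<alpha>s)" by (rule \<alpha>_consistent)
    show "\<exists>e. little_op1 M e \<and>
          (\<forall>\<^sub>F n in sequentially. AE \<omega> in M.
             \<theta>h n \<omega> = real n powr ((\<gamma> - \<alpha>s) / (1 - \<alpha>s))
               * (\<alpha>s * C \<omega> * L (real n)) powr (1 / (1 - \<alpha>s)) * (1 + e n \<omega>))" if "\<alpha>s < \<gamma>"
      by (rule \<theta>_regime_divergent[OF V_at_top[OF that]])
    show "\<exists>e. little_op1 M e \<and>
          (\<forall>\<^sub>F n in sequentially. AE \<omega> in M.
             \<theta>h n \<omega> = (\<gamma> * C \<omega> * L (real n)) powr (1 / (1 - \<gamma>)) * (1 + e n \<omega>))"
      if *: "\<alpha>s = \<gamma> \<and> filterlim (\<lambda>n. L (real n)) at_top sequentially"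
    proof -
      have "filterlim V at_top sequentially"
        unfolding V_critical[OF conjunct1[OF *], abs_def]
        using * by (intro filterlim_compose[OF ln_at_top]) auto
      from \<theta>_regime_divergent[OF this] obtain e where e: "little_op1 M e"
        "\<forall>\<^sub>F n in sequentially. AE \<omega> in M.
             \<theta>h n \<omega> = real n powr ((\<gamma> - \<alpha>s) / (1 - \<alpha>s))
               * (\<alpha>s * C \<omega> * L (real n)) powr (1 / (1 - \<alpha>s)) * (1 + e n \<omega>)" by blast
      have "\<forall>\<^sub>F n in sequentially. AE \<omega> in M. \<theta>h n \<omega> = (\<gamma> * C \<omega> * L (real n)) powr (1 / (1 - \<gamma>)) * (1 + e n \<omega>)"
        \<comment> \<open>Since \<open>0 powr 0 = 0\<close>, the factor \<open>n powr 0\<close>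
          equals 1 only for positive n.\<close>
        using e(2) eventually_gt_at_top[of 0] by eventually_elim (use * in simp)
      with e(1) show ?thesis by blast
    qed
    show "big_Op1 M \<theta>h" if "\<alpha>s = \<gamma> \<and> (\<lambda>n. L (real n)) \<in> O(\<lambda>_. 1)"
      using \<theta>_regime_bounded that by blast
    show "\<exists>e. little_op1 M e \<and> (\<forall>n. AE \<omega> in M. \<theta>h n \<omega> = - \<alpha>s + e n \<omega>)" if "\<gamma> < \<alpha>s"
      using \<theta>_regime_boundary[OF that] by (intro exI[of _ "\<lambda>n \<omega>. \<theta>h n \<omega> + \<alpha>s"]) auto
  qed
qed

end
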